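(* Let $1<p<\infty$. Let $\Omega_1$ and $\Omega_2$ be open subsets of $\mathbb{C}$ such that $\Omega_1\cap\Omega_2\neq\emptyset$ and $\operatorname{dist}(\Omega_1\setminus\Omega_2,\ \Omega_2\setminus\Omega_1)>0$. If in addition $\Omega_1\cap\Omega_2$ is bounded and $\overline{\Omega_1\cup\Omega_2}\neq\mathbb{C}$, then $$A^p(\Omega_1\cap\Omega_2)=A^p(\Omega_1)+A^p(\Omega_2).$$
   Context: For an open set $\Omega\subset\mathbb{C}$ and $1\le p<\infty$, the Bergman space $A^p(\Omega)$ consists of all holomorphic functions $f$ on $\Omega$ with $\int_\Omega |f(x+iy)|^p\,dx\,dy<+\infty$. For sets $A,B\subset\mathbb{C}$, $\operatorname{dist}(A,B)=\inf\{|a-b|:a\in A,\ b\in B\}$. The sum $A^p(\Omega_1)+A^p(\Omega_2)$ is the set of functions on $\Omega_1\cap\Omega_2$ of the form $f_1|_{\Omega_1\cap\Omega_2}+f_2|_{\Omega_1\cap\Omega_2}$ with $f_i\in A^p(\Omega_i)$. *)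

theory Defs
  imports "HOL-Complex_Analysis.Complex_Analysis"
begin

text \<open>
  The Bergman space \<open>A\<^sup>p(\<Omega>)\<close>. Functions on \<open>\<Omega>\<close> are encoded as total functions that are
  \<^const>\<open>undefined\<close> off \<open>\<Omega>\<close>, so that equality in the space is equality on \<open>\<Omega>\<close>.
  On \<^typ>\<open>complex\<close>, \<^const>\<open>lborel\<close> is the area measure \<open>dx dy\<close>.
\<close>

definition bergman_space :: "real \<Rightarrow> complex set \<Rightarrow> (complex \<Rightarrow> complex) set" where
  "bergman_space p \<Omega> = {f \<in> extensional \<Omega>. f holomorphic_on \<Omega> \<and>
     (\<integral>\<^sup>+z\<in>\<Omega>. ennreal (cmod (f z) powr p) \<partial>lborel) < \<infinity>}"

definition bergman_sum ::
  "real \<Rightarrow> complex set \<Rightarrow> complex set \<Rightarrow> (complex \<Rightarrow> complex) set" where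
  "bergman_sum p \<Omega>\<^sub>1 \<Omega>\<^sub>2 =
     {\<lambda>z \<in> \<Omega>\<^sub>1 \<inter> \<Omega>\<^sub>2. f\<^sub>1 z + f\<^sub>2 z | f\<^sub>1 f\<^sub>2.
        f\<^sub>1 \<in> bergman_space p \<Omega>\<^sub>1 \<and> f\<^sub>2 \<in> bergman_space p \<Omega>\<^sub>2}"

text \<open>
  The value is extended real so that the infimum over the empty family is \<open>\<infinity>\<close>; thus nested
  sets satisfy the separation condition. In contrast, \<^const>\<open>setdist\<close> is \<open>0\<close> if one of the
  sets is empty.
\<close>

definition set_distance :: "complex set \<Rightarrow> complex set \<Rightarrow> ereal" where
  "set_distance A B = (INF a\<in>A. INF b\<in>B. ereal (cmod (a - b)))"

end

theory Submission
  imports Defs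
begin

text \<open>
  Since the two differences \<open>\<Omega>\<^sub>1 - \<Omega>\<^sub>2\<close> and \<open>\<Omega>\<^sub>2 - \<Omega>\<^sub>1\<close> are separated, there is a \<open>C\<^sup>1\<close> cutoff
  \<open>\<phi>\<close> with gradient bounded on \<open>\<Omega>\<^sub>1 \<inter> \<Omega>\<^sub>2\<close> that is \<open>0\<close> near the first and \<open>1\<close> near the second;
  it is a polynomial approximation of a distance function, composed with a smooth step.
  Given \<open>f\<close> on the intersection, \<open>\<phi> f\<close> and \<open>(1 - \<phi>) f\<close> extend by zero to \<open>\<Omega>\<^sub>1\<close> and \<open>\<Omega>\<^sub>2\<close>,
  but are not holomorphic. Both are repaired by a solution \<open>u\<close> of the \<open>dbar\<close>-equation
  with right-hand side \<open>f dbar \<phi>\<close>: take \<open>f\<^sub>1 = \<phi> f - u\<close> and \<open>f\<^sub>2 = (1 - \<phi>) f + u\<close>.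
  The right-hand side is \<open>L\<^sup>p\<close> with bounded support, so \<open>u\<close> may be taken to be a Cauchy transform
  whose kernel is modified by means of a point \<open>a\<close> outside the closure of \<open>\<Omega>\<^sub>1 \<union> \<Omega>\<^sub>2\<close>.
\<close>

subsection \<open>Integrals over the plane\<close>

text \<open>The density \<open>f * dbar \<phi>\<close> is only \<open>L^p\<close> and may blow up at
  the boundary of the intersection, so the Cauchy-Pompeiu formula, available here for
  \<open>C^1\<close> functions of bounded support, does not apply to \<open>\<phi> * f\<close>
  itself. But holomorphy is local. Near a point of the intersection, \<open>\<phi> * f\<close> is
  replaced by a \<open>C^1\<close> function of bounded support that agrees with it there; the two
  densities then differ by one that vanishes near the point, and the Cauchy transform of such a
  density is holomorphic there. Near a point of one set outside the other, the density itself
  vanishes because the cutoff is constant on the nearby part of the intersection. Boundary points of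
  the intersection that lie in neither set require nothing, so the blow-up there is harmless.
  Boundedness of the intersection serves twice: polynomial approximation controls the cutoff only on
  a disc, and on bounded support an \<open>L^p\<close> density is \<open>L^1\<close>.\<close>

lemma nn_integral_complex_prod:
  assumes [measurable]: "f \<in> borel_measurable borel" "g \<in> borel_measurable borel"
  shows "(\<integral>\<^sup>+z. f (Re z) * g (Im z) \<partial>lborel) = (\<integral>\<^sup>+x. f x \<partial>lborel) * (\<integral>\<^sup>+y. g y \<partial>lborel)"
proof -
  let ?h = "\<lambda>b::complex. if b = 1 then f else g"
  have "(\<integral>\<^sup>+z. (\<Prod>b\<in>Basis. ?h b (z \<bullet> b)) \<partial>lborel) = (\<Prod>b\<in>Basis. (\<integral>\<^sup>+x. ?h b x \<partial>lborel))"
    by (intro nn_integral_lborel_prod) auto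
  then show ?thesis
    by (simp add: Basis_complex_def)
qed

text \<open>Split at 0 and reflect the negative half. The point 0 is counted in both halves, hence
  an inequality, which suffices for finiteness.\<close>

lemma nn_integral_even_le:
  fixes f :: "real \<Rightarrow> ennreal"
  assumes [measurable]: "f \<in> borel_measurable borel"
  shows "(\<integral>\<^sup>+x. f \<bar>x\<bar> \<partial>lborel) \<le> 2 * (\<integral>\<^sup>+x. f x * indicator {0..} x \<partial>lborel)"
proof -
  have "(\<integral>\<^sup>+x. f \<bar>x\<bar> \<partial>lborel)
      \<le> (\<integral>\<^sup>+x. f x * indicator {0..} x + f (-x) * indicator {0..} (-x) \<partial>lborel)"
    by (intro nn_integral_mono) (auto simp: indicator_def abs_if)
  also have "\<dots> = (\<integral>\<^sup>+x. f x * indicator {0..} x \<partial>lborel) + (\<integral>\<^sup>+x. f (-x) * indicator {0..} (-x) \<partial>lborel)"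
    by (intro nn_integral_add) auto
  also have "(\<integral>\<^sup>+x. f (-x) * indicator {0..} (-x) \<partial>lborel) = (\<integral>\<^sup>+x. f x * indicator {0..} x \<partial>lborel)"
    using nn_integral_real_affine[of "\<lambda>x. f x * indicator {0..} x" "-1" 0] by simp
  finally show ?thesis by (simp add: mult_2)
qed

text \<open>Cartesian substitute for polar coordinates: \<open>|x| |y| \<le> |z|^2\<close> gives
  \<open>1 / |z| \<le> |x| powr (-1/2) * |y| powr (-1/2)\<close>, a product of two integrable
  one-dimensional singularities.\<close>

lemma nn_integral_inverse_cmod_finite:
  "(\<integral>\<^sup>+z. ennreal (indicator (cball 0 R) z / cmod z) \<partial>lborel) < \<infinity>"
proof -
  define a where "a = (\<lambda>x::real. ennreal (indicator {0..R} x * x powr (-1/2)))"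
  have [measurable]: "a \<in> borel_measurable borel" unfolding a_def by measurable
  have "(\<integral>\<^sup>+x. a x * indicator {0..} x \<partial>lborel) < \<infinity>"
  proof (cases "0 \<le> R")
    case True
    have "((\<lambda>x. x powr (-1/2)) has_integral (R powr (-1/2+1) / (-1/2+1))) {0..R}"
      using True by (intro has_integral_powr_from_0) auto
    then have "((\<lambda>x. indicator {0..R} x * x powr (-1/2)) has_integral (R powr (-1/2+1) / (-1/2+1))) UNIV"
      by (subst (asm) has_integral_restrict_UNIV[symmetric])
        (auto elim!: has_integral_eq_rhs[OF has_integral_cong[THEN iffD1, rotated]] simp: indicator_def)
    then have "(\<integral>\<^sup>+x. a x \<partial>lborel) = ennreal (R powr (-1/2+1) / (-1/2+1))"
      unfolding a_def by (intro nn_integral_has_integral_lborel) auto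
    moreover have "(\<integral>\<^sup>+x. a x * indicator {0..} x \<partial>lborel) \<le> (\<integral>\<^sup>+x. a x \<partial>lborel)"
      by (intro nn_integral_mono) (auto simp: indicator_def)
    ultimately show ?thesis by (simp add: order.strict_trans1)
  next
    case False
    then show ?thesis by (simp add: a_def)
  qed
  then have fin: "(\<integral>\<^sup>+x. a \<bar>x\<bar> \<partial>lborel) < \<infinity>"
    using nn_integral_even_le[of a] by (simp add: ennreal_mult_less_top order.strict_trans1)
  \<comment> \<open>The axes must be discarded: \<open>0 powr (-1/2)\<close> is 0 by convention, so
    the majorant vanishes there and the pointwise bound fails.\<close>
  have nz: "AE z in lborel. Re z \<noteq> 0" "AE z in lborel. Im z \<noteq> 0"
  proof -
    have "(\<integral>\<^sup>+z. indicator {0} (Re z) * 1 \<partial>lborel) = (\<integral>\<^sup>+x. indicator {0::real} x \<partial>lborel) * integral\<^sup>N lborel (\<lambda>_::real. 1)"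
      by (rule nn_integral_complex_prod) auto
    also have "(\<integral>\<^sup>+z. indicator {0} (Re z) * 1 \<partial>lborel) = (\<integral>\<^sup>+z. indicator {z. Re z = 0} z \<partial>lborel)"
      by (intro nn_integral_cong) (auto simp: indicator_def)
    finally have "{z::complex. Re z = 0} \<in> null_sets lborel"
      by (intro null_setsI) auto
    then show "AE z in lborel. Re z \<noteq> 0" by (rule AE_I') auto
    have "(\<integral>\<^sup>+z. 1 * indicator {0} (Im z) \<partial>lborel) = integral\<^sup>N lborel (\<lambda>_::real. 1) * (\<integral>\<^sup>+x. indicator {0::real} x \<partial>lborel)"
      by (rule nn_integral_complex_prod) auto
    also have "(\<integral>\<^sup>+z. 1 * indicator {0} (Im z) \<partial>lborel) = (\<integral>\<^sup>+z. indicator {z. Im z = 0} z \<partial>lborel)"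
      by (intro nn_integral_cong) (auto simp: indicator_def)
    finally have "{z::complex. Im z = 0} \<in> null_sets lborel"
      by (intro null_setsI) auto
    then show "AE z in lborel. Im z \<noteq> 0" by (rule AE_I') auto
  qed
  have "(\<integral>\<^sup>+z. ennreal (indicator (cball 0 R) z / cmod z) \<partial>lborel) \<le> (\<integral>\<^sup>+z. a \<bar>Re z\<bar> * a \<bar>Im z\<bar> \<partial>lborel)"
  proof (rule nn_integral_mono_AE)
    show "AE z in lborel. ennreal (indicator (cball 0 R) z / cmod z) \<le> a \<bar>Re z\<bar> * a \<bar>Im z\<bar>"
      using nz
    proof eventually_elim
      case (elim z)
      show ?case
      proof (cases "cmod z \<le> R")
        case True
        then have R: "\<bar>Re z\<bar> \<le> R" "\<bar>Im z\<bar> \<le> R"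
          using abs_Re_le_cmod[of z] abs_Im_le_cmod[of z] by auto
        let ?x = "\<bar>Re z\<bar>" and ?y = "\<bar>Im z\<bar>"
        have "?x * ?y \<le> (cmod z)\<^sup>2"
          using abs_Re_le_cmod[of z] abs_Im_le_cmod[of z] by (simp add: power2_eq_square mult_mono)
        then have "sqrt (?x * ?y) \<le> cmod z"
          by (simp add: real_le_lsqrt)
        then have "1 / cmod z \<le> 1 / sqrt (?x * ?y)"
          using elim by (intro divide_left_mono) (auto intro!: mult_pos_pos)
        also have "\<dots> = ?x powr (-1/2) * ?y powr (-1/2)"
          using elim by (simp add: powr_half_sqrt powr_minus real_sqrt_mult field_simps)
        finally show ?thesis
          using True R by (simp add: a_def indicator_def ennreal_mult''[symmetric])
      qed (simp add: indicator_def)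
    qed
  qed
  also have "\<dots> = (\<integral>\<^sup>+x. a \<bar>x\<bar> \<partial>lborel) * (\<integral>\<^sup>+x. a \<bar>x\<bar> \<partial>lborel)"
    by (rule nn_integral_complex_prod) auto
  also have "\<dots> < \<infinity>" using fin by (simp add: ennreal_mult_less_top)
  finally show ?thesis .
qed

text \<open>Since \<open>(1 + |z|)^2\<close> dominates \<open>(1 + |x|) * (1 + |y|)\<close>, the
  integrand lies below a product of one-dimensional tails, integrable because \<open>q > 1\<close>.
  With \<open>q = p\<close> this is the integrability at infinity of the corrected
  transform.\<close>

lemma nn_integral_cmod_powr_finite:
  assumes "1 < q"
  shows "(\<integral>\<^sup>+z. ennreal ((1 + cmod z) powr (-2 * q)) \<partial>lborel) < \<infinity>"
proof -
  define a where "a = (\<lambda>x::real. ennreal ((1 + x) powr (-q)))"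
  have [measurable]: "a \<in> borel_measurable borel" unfolding a_def by measurable
  have "(\<integral>\<^sup>+x. a x * indicator {0..} x \<partial>lborel) = ennreal (0 - ((1 + 0) powr (1 - q) / (1 - q)))"
    unfolding a_def
  proof (rule nn_integral_FTC_atLeast)
    show "((\<lambda>x. (1 + x) powr (1 - q) / (1 - q)) has_real_derivative (1 + x) powr (-q)) (at x)" if "0 \<le> x" for x
    proof -
      have "((\<lambda>x. (1 + x) powr (1 - q)) has_real_derivative (1 - q) * (1 + x) powr (1 - q - 1) * (0 + 1)) (at x)"
        using that by (intro has_real_derivative_powr[THEN DERIV_chain2] derivative_intros) auto
      from DERIV_cdivide[OF this, of "1 - q"] show ?thesis
        using assms by simp
    qed
    show "((\<lambda>x. (1 + x) powr (1 - q) / (1 - q)) \<longlongrightarrow> 0) at_top"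
      using tendsto_divide[OF tendsto_neg_powr[of "1 - q" "\<lambda>x. 1 + x" at_top] tendsto_const[of "1 - q"]] assms
      by (simp add: filterlim_tendsto_add_at_top[OF tendsto_const filterlim_ident])
  qed auto
  then have fin: "(\<integral>\<^sup>+x. a \<bar>x\<bar> \<partial>lborel) < \<infinity>"
    using nn_integral_even_le[of a] by (simp add: ennreal_mult_less_top order.strict_trans1)
  have "(\<integral>\<^sup>+z. ennreal ((1 + cmod z) powr (-2 * q)) \<partial>lborel) \<le> (\<integral>\<^sup>+z. a \<bar>Re z\<bar> * a \<bar>Im z\<bar> \<partial>lborel)"
  proof (rule nn_integral_mono)
    fix z
    have "(1 + cmod z) powr (-2 * q) = ((1 + cmod z) * (1 + cmod z)) powr (-q)"
      by (simp add: powr_mult flip: powr_add)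
    also have "\<dots> \<le> ((1 + \<bar>Re z\<bar>) * (1 + \<bar>Im z\<bar>)) powr (-q)"
      using assms abs_Re_le_cmod[of z] abs_Im_le_cmod[of z]
      by (intro powr_mono2' mult_mono mult_pos_pos) auto
    also have "\<dots> = (1 + \<bar>Re z\<bar>) powr (-q) * (1 + \<bar>Im z\<bar>) powr (-q)"
      by (simp add: powr_mult)
    finally show "ennreal ((1 + cmod z) powr (-2 * q)) \<le> a \<bar>Re z\<bar> * a \<bar>Im z\<bar>"
      by (simp add: a_def ennreal_mult''[symmetric] ennreal_leI)
  qed
  also have "\<dots> = (\<integral>\<^sup>+x. a \<bar>x\<bar> \<partial>lborel) * (\<integral>\<^sup>+x. a \<bar>x\<bar> \<partial>lborel)"
    by (rule nn_integral_complex_prod) auto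
  also have "\<dots> < \<infinity>" using fin by (simp add: ennreal_mult_less_top)
  finally show ?thesis .
qed

lemma nn_integral_inverse_cmod_shift:
  "(\<integral>\<^sup>+w. ennreal (indicator (cball z R) w / cmod (w - z)) \<partial>lborel)
    = (\<integral>\<^sup>+w. ennreal (indicator (cball 0 R) w / cmod w) \<partial>lborel)"
proof -
  have "(\<integral>\<^sup>+w. ennreal (indicator (cball z R) w / cmod (w - z)) \<partial>lborel)
      = (\<integral>\<^sup>+w. ennreal (indicator (cball z R) w / cmod (w - z)) \<partial>distr lborel borel ((+) z))"
    by (simp add: lborel_distr_plus)
  also have "\<dots> = (\<integral>\<^sup>+w. ennreal (indicator (cball 0 R) w / cmod w) \<partial>lborel)"
    by (subst nn_integral_distr) (auto intro!: nn_integral_cong simp: indicator_def dist_norm)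
  finally show ?thesis .
qed

lemma integrable_inverse_cmod:
  "integrable lborel (\<lambda>w. indicator (cball z R) w / cmod (w - z))"
proof (rule integrableI_bounded)
  show "(\<integral>\<^sup>+w. ennreal (norm (indicator (cball z R) w / cmod (w - z) :: real)) \<partial>lborel) < \<infinity>"
    using nn_integral_inverse_cmod_finite nn_integral_inverse_cmod_shift by simp
qed (intro borel_measurable_divide borel_measurable_indicator; measurable)

lemma integral_lborel_affine:
  fixes f :: "'a::euclidean_space \<Rightarrow> 'b::{banach, second_countable_topology}"
  assumes [measurable]: "f \<in> borel_measurable borel" and "c \<noteq> 0"
  shows "(\<integral>x. f x \<partial>lborel) = \<bar>c\<bar> ^ DIM('a) *\<^sub>R (\<integral>x. f (t + c *\<^sub>R x) \<partial>lborel)"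
  by (subst lborel_affine[OF assms(2), of t])
    (simp add: integral_density integral_distr)

lemma integral_lborel_shift:
  fixes f :: "'a::euclidean_space \<Rightarrow> 'b::{banach, second_countable_topology}"
  assumes [measurable]: "f \<in> borel_measurable borel"
  shows "(\<integral>x. f (x + t) \<partial>lborel) = (\<integral>x. f x \<partial>lborel)"
  using integral_lborel_affine[of f 1 t] by (simp add: add.commute)

subsection \<open>Continuously differentiable functions and the operator dbar\<close>

text \<open>Continuity is required for each fixed direction \<open>e\<close>; in finite dimension
  this amounts to continuity of the derivative as a linear map.\<close>

definition C1_on :: "complex set \<Rightarrow> (complex \<Rightarrow> complex) \<Rightarrow> bool" where
  "C1_on S f \<longleftrightarrow> (\<forall>z\<in>S. f differentiable (at z)) \<and>
     (\<forall>e. continuous_on S (\<lambda>z. frechet_derivative f (at z) e))"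

text \<open>This is twice the usual \<open>\<partial>f/\<partial>z\<^sup>*\<close>.\<close>
definition dbar :: "(complex \<Rightarrow> complex) \<Rightarrow> complex \<Rightarrow> complex" where
  "dbar f z = frechet_derivative f (at z) 1 + \<i> * frechet_derivative f (at z) \<i>"

lemma dbar_eq: "(f has_derivative f') (at z) \<Longrightarrow> dbar f z = f' 1 + \<i> * f' \<i>"
  by (simp add: dbar_def flip: frechet_derivative_at)

lemma C1_onI:
  assumes "\<And>z. z \<in> S \<Longrightarrow> (f has_derivative f' z) (at z)" "\<And>e. continuous_on S (\<lambda>z. f' z e)"
  shows "C1_on S f"
  unfolding C1_on_def
proof (intro conjI allI ballI)
  show "f differentiable (at z)" if "z \<in> S" for z
    using assms(1)[OF that] by (rule differentiableI)
  show "continuous_on S (\<lambda>z. frechet_derivative f (at z) e)" for e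
    using assms(2)[of e] by (subst continuous_on_cong[OF refl, of _ _ "\<lambda>z. f' z e"])
      (auto simp flip: frechet_derivative_at[OF assms(1)])
qed

lemma C1_on_has_derivative:
  "C1_on S f \<Longrightarrow> z \<in> S \<Longrightarrow> (f has_derivative frechet_derivative f (at z)) (at z)"
  by (simp add: C1_on_def flip: frechet_derivative_works)

lemma C1_on_continuous_on: "C1_on S f \<Longrightarrow> continuous_on S f"
  by (meson C1_on_def continuous_at_imp_continuous_on differentiable_imp_continuous_within)

lemma C1_on_continuous_on_frechet: "C1_on S f \<Longrightarrow> continuous_on S (\<lambda>z. frechet_derivative f (at z) e)"
  by (simp add: C1_on_def)

lemma C1_on_continuous_on_dbar: "C1_on S f \<Longrightarrow> continuous_on S (dbar f)"
  unfolding dbar_def[abs_def] by (intro continuous_intros C1_on_continuous_on_frechet)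

lemma C1_on_subset: "C1_on S f \<Longrightarrow> T \<subseteq> S \<Longrightarrow> C1_on T f"
  by (auto simp: C1_on_def intro: continuous_on_subset)

lemma C1_on_Un: "open S \<Longrightarrow> open T \<Longrightarrow> C1_on S f \<Longrightarrow> C1_on T f \<Longrightarrow> C1_on (S \<union> T) f"
  by (auto simp: C1_on_def intro: continuous_on_open_Un)

lemma dbar_cong:
  assumes "open S" "z \<in> S" "\<And>w. w \<in> S \<Longrightarrow> f w = g w"
  shows "dbar f z = dbar g z"
proof -
  have *: "v differentiable at z" if u: "u differentiable at z" and uv: "\<And>w. w \<in> S \<Longrightarrow> u w = v w"
    for u v :: "complex \<Rightarrow> complex"
  proof -
    obtain D where "(u has_derivative D) (at z)" using u by (auto simp: differentiable_def)
    from has_derivative_transform_within_open[OF this assms(1,2) uv]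
    show ?thesis by (rule differentiableI)
  qed
  have "f differentiable at z \<longleftrightarrow> g differentiable at z"
    using *[of f g] *[of g f] assms(3) by auto
  moreover have "frechet_derivative f (at z) = frechet_derivative g (at z)" if "f differentiable at z"
    using frechet_derivative_transform_within_open[OF that assms(1,2)] assms(3) by blast
  \<comment> \<open>With no derivative, both sides are a choice from the same empty predicate, hence
    still equal.\<close>
  moreover have "frechet_derivative f (at z) = frechet_derivative g (at z)" if "\<not> f differentiable at z"
    using that calculation(1) by (simp add: frechet_derivative_def differentiable_def)
  ultimately show ?thesis by (auto simp: dbar_def)
qed

lemma C1_on_cong:
  assumes "open S" "C1_on S f" "\<And>z. z \<in> S \<Longrightarrow> f z = g z"
  shows "C1_on S g"
proof (rule C1_onI)
  show "(g has_derivative frechet_derivative f (at z)) (at z)" if "z \<in> S" for z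
    using has_derivative_transform_within_open[OF C1_on_has_derivative[OF assms(2) that] assms(1) that]
      assms(3) by blast
  show "continuous_on S (\<lambda>z. frechet_derivative f (at z) e)" for e
    using assms(2) by (rule C1_on_continuous_on_frechet)
qed

lemma C1_on_const: "C1_on S (\<lambda>z. c)"
  by (rule C1_onI[where f' = "\<lambda>_ _. 0"]) auto

lemma C1_on_mult:
  assumes "C1_on S f" "C1_on S g"
  shows "C1_on S (\<lambda>z. f z * g z)"
  by (rule C1_onI[OF has_derivative_mult[OF C1_on_has_derivative C1_on_has_derivative]])
    (use assms in \<open>auto intro!: continuous_intros intro: C1_on_continuous_on C1_on_continuous_on_frechet\<close>)

lemma C1_on_diff:
  assumes "C1_on S f" "C1_on S g"
  shows "C1_on S (\<lambda>z. f z - g z)"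
  by (rule C1_onI[OF has_derivative_diff[OF C1_on_has_derivative C1_on_has_derivative]])
    (use assms in \<open>auto intro!: continuous_intros intro: C1_on_continuous_on C1_on_continuous_on_frechet\<close>)

lemma dbar_mult:
  assumes "f differentiable at z" "g differentiable at z"
  shows "dbar (\<lambda>z. f z * g z) z = f z * dbar g z + dbar f z * g z"
  using dbar_eq[OF has_derivative_mult[OF assms[unfolded frechet_derivative_works]]]
  by (simp add: dbar_def algebra_simps)

lemma dbar_diff:
  assumes "f differentiable at z" "g differentiable at z"
  shows "dbar (\<lambda>z. f z - g z) z = dbar f z - dbar g z"
  using dbar_eq[OF has_derivative_diff[OF assms[unfolded frechet_derivative_works]]]
  by (simp add: dbar_def algebra_simps)

lemma dbar_const [simp]: "dbar (\<lambda>z. c) z = 0"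
  by (simp add: dbar_def)

text \<open>Cauchy-Riemann: the derivative is multiplication by some \<open>c\<close>, and
  \<open>c + \<i> * (c * \<i>) = 0\<close>.\<close>

lemma dbar_holomorphic:
  assumes "open S" "f holomorphic_on S" "z \<in> S"
  shows "dbar f z = 0"
  using dbar_eq[OF has_field_derivative_imp_has_derivative[OF holomorphic_derivI[OF assms(2,1,3)]]]
  by (simp add: mult.left_commute[of \<i>])

lemma C1_on_holomorphic:
  assumes "open S" "f holomorphic_on S"
  shows "C1_on S f"
  by (rule C1_onI[OF has_field_derivative_imp_has_derivative[OF holomorphic_derivI[OF assms(2,1)]]])
    (use assms in \<open>auto intro!: continuous_intros intro: holomorphic_on_imp_continuous_on holomorphic_deriv\<close>)

section \<open>Functions of bounded support and integrals of their derivatives\<close>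

lemma continuous_bounded_support:
  fixes f :: "complex \<Rightarrow> complex"
  assumes "continuous_on UNIV f" "\<And>z. R < cmod z \<Longrightarrow> f z = 0"
  obtains M where "0 < M" "\<And>z. cmod (f z) \<le> M * indicator (cball 0 R) z" "\<And>z. cmod (f z) \<le> M"
proof -
  have "bounded (f ` cball 0 R)"
    by (intro compact_imp_bounded compact_continuous_image continuous_on_subset[OF assms(1)]) auto
  then obtain M where M: "0 < M" "\<And>z. z \<in> cball 0 R \<Longrightarrow> cmod (f z) \<le> M"
    by (auto simp: bounded_pos)
  have 1: "cmod (f z) \<le> M * indicator (cball 0 R) z" for z
    using M(2)[of z] assms(2)[of z] by (cases "R < cmod z") auto
  have 2: "cmod (f z) \<le> M" for z
    using 1[of z] M(1) by (cases "z \<in> cball 0 R") auto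
  show ?thesis by (rule that[OF M(1) 1 2])
qed

lemma integrable_bounded_support:
  fixes f :: "complex \<Rightarrow> complex"
  assumes "f \<in> borel_measurable borel" "\<And>z. cmod (f z) \<le> M * indicator (cball 0 R) z"
  shows "integrable lborel f"
proof (rule Bochner_Integration.integrable_bound)
  show "integrable lborel (\<lambda>z::complex. M * indicator (cball 0 R) z)"
    by (intro integrable_mult_right integrable_real_indicator) (auto intro!: emeasure_bounded_finite[unfolded infinity_ennreal_def])
  show "AE z in lborel. cmod (f z) \<le> norm (M * indicator (cball 0 R) z)"
    using assms(2) by (intro always_eventually allI) (simp add: order_trans[OF _ abs_ge_self])
qed (use assms in auto)

lemma integrable_continuous_support:
  fixes f :: "complex \<Rightarrow> complex"
  assumes f: "continuous_on UNIV f" and R: "\<And>z. R < cmod z \<Longrightarrow> f z = 0"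
  shows "integrable lborel f"
proof -
  obtain M where "\<And>z. cmod (f z) \<le> M * indicator (cball 0 R) z"
    using continuous_bounded_support[OF f R] by metis
  then show ?thesis
    using borel_measurable_continuous_onI[OF f] integrable_bounded_support by blast
qed

lemma frechet_derivative_support:
  assumes "C1_on UNIV F" "\<And>z. R < cmod z \<Longrightarrow> F z = 0" "R < cmod z"
  shows "frechet_derivative F (at z) = (\<lambda>_. 0)"
proof -
  have "frechet_derivative F (at z) = frechet_derivative (\<lambda>_. 0) (at z)"
    by (rule frechet_derivative_transform_within_open[where X = "{z. R < cmod z}"])
      (use assms in \<open>auto simp: C1_on_def intro!: open_Collect_less continuous_intros\<close>)
  then show ?thesis by simp
qed

text \<open>The integral vanishes since the integral of \<open>F (z + t e)\<close> over \<open>z\<close> does not depend on \<open>t\<close>.\<close>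
lemma
  assumes F: "C1_on UNIV F" and supp: "\<And>z. R < cmod z \<Longrightarrow> F z = 0"
  shows integrable_frechet_derivative: "integrable lborel (\<lambda>z. frechet_derivative F (at z) e)"
    and integral_frechet_derivative: "(\<integral>z. frechet_derivative F (at z) e \<partial>lborel) = 0"
proof -
  define D where "D = (\<lambda>z. frechet_derivative F (at z) e)"
  have cD: "continuous_on UNIV D" unfolding D_def by (rule C1_on_continuous_on_frechet[OF F])
  have D0: "D z = 0" if "R < cmod z" for z
    using frechet_derivative_support[OF F supp that] by (simp add: D_def)
  obtain M where M: "0 < M" "\<And>z. cmod (D z) \<le> M * indicator (cball 0 R) z" "\<And>z. cmod (D z) \<le> M"
    using continuous_bounded_support[OF cD D0] by blast
  have cF: "continuous_on UNIV F" by (rule C1_on_continuous_on[OF F])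
  obtain N where N: "\<And>z. cmod (F z) \<le> N * indicator (cball 0 R) z"
    using continuous_bounded_support[OF cF supp] by blast
  have [measurable]: "F \<in> borel_measurable borel" "D \<in> borel_measurable borel"
    using cF cD by (auto intro: borel_measurable_continuous_onI)
  have intF: "integrable lborel F" by (rule integrable_bounded_support[OF _ N]) simp
  have intD: "integrable lborel D" by (rule integrable_bounded_support[OF _ M(2)]) simp
  \<comment> \<open>Difference quotients in direction \<open>e\<close> with step
    \<open>1 / (n + 1)\<close>. Each has integral 0 by translation invariance, and they converge to
    \<open>D\<close>.\<close>
  define H where "H = (\<lambda>n z. real (Suc n) *\<^sub>R (F (z + e /\<^sub>R real (Suc n)) - F z))"
  have [measurable]: "H n \<in> borel_measurable borel" for n unfolding H_def by measurable
  have intH: "(\<integral>z. H n z \<partial>lborel) = 0" for n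
  proof -
    have "integrable lborel (\<lambda>z. F (z + e /\<^sub>R real (Suc n)))"
    proof -
      have "integrable (distr lborel borel ((+) (e /\<^sub>R real (Suc n)))) F"
        using intF by (simp add: lborel_distr_plus)
      then show ?thesis by (subst (asm) integrable_distr_eq) (auto simp: add.commute)
    qed
    then show ?thesis
      using intF unfolding H_def by (simp add: integral_lborel_shift del: of_nat_Suc)
  qed
  have lim: "(\<lambda>n. H n z) \<longlonglongrightarrow> D z" for z
  proof -
    let ?G = "\<lambda>t::real. F (z + t *\<^sub>R e)"
    have "(?G has_derivative (\<lambda>t. frechet_derivative F (at z) (t *\<^sub>R e))) (at 0)"
      by (rule has_derivative_compose[where f = "\<lambda>t. z + t *\<^sub>R e" and g = F and f' = "\<lambda>t. t *\<^sub>R e"])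
        (use C1_on_has_derivative[OF F, of z] in \<open>auto intro!: derivative_eq_intros\<close>)
    then have "(\<lambda>t. (?G t - ?G 0 - frechet_derivative F (at z) (t *\<^sub>R e)) /\<^sub>R norm t) \<midarrow>0\<rightarrow> 0"
      by (simp add: has_derivative_at_within has_derivative_at2)
    moreover have "filterlim (\<lambda>n. 1 / real (Suc n)) (at 0) sequentially"
      by (intro filterlim_atI LIMSEQ_inverse_real_of_nat[unfolded inverse_eq_divide]) auto
    ultimately have "(\<lambda>n. (?G (1 / real (Suc n)) - ?G 0 - frechet_derivative F (at z) ((1 / real (Suc n)) *\<^sub>R e)) /\<^sub>R norm (1 / real (Suc n))) \<longlonglongrightarrow> 0"
      by (rule filterlim_compose)
    also have "(\<lambda>n. (?G (1 / real (Suc n)) - ?G 0 - frechet_derivative F (at z) ((1 / real (Suc n)) *\<^sub>R e)) /\<^sub>R norm (1 / real (Suc n))) = (\<lambda>n. H n z - D z)"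
    proof
      fix n
      have "frechet_derivative F (at z) ((1 / real (Suc n)) *\<^sub>R e) = (1 / real (Suc n)) *\<^sub>R D z"
        unfolding D_def using F
        by (intro linear_scale linear_frechet_derivative) (auto simp: C1_on_def)
      then show "(?G (1 / real (Suc n)) - ?G 0 - frechet_derivative F (at z) ((1 / real (Suc n)) *\<^sub>R e)) /\<^sub>R norm (1 / real (Suc n)) = H n z - D z"
        by (simp add: H_def scaleR_diff_right inverse_eq_divide del: of_nat_Suc)
    qed
    finally show ?thesis by (simp add: LIM_zero_cancel)
  qed
  \<comment> \<open>Majorant from the mean value inequality. The disc grows by \<open>cmod e\<close>
    because the shifted point may meet the support when \<open>z\<close> does not; the steps are at
    most 1.\<close>
  have bound: "cmod (H n z) \<le> M * indicator (cball 0 (R + cmod e)) z" for n z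
  proof (cases "z \<in> cball 0 (R + cmod e)")
    case True
    let ?G = "\<lambda>t::real. F (z + t *\<^sub>R e)" and ?t = "1 / real (Suc n)"
    have G: "(?G has_derivative (\<lambda>s. s *\<^sub>R D (z + t *\<^sub>R e))) (at t)" for t
    proof -
      have lin: "linear (frechet_derivative F (at (z + t *\<^sub>R e)))"
        using F by (intro linear_frechet_derivative) (auto simp: C1_on_def)
      have "(?G has_derivative (\<lambda>s. frechet_derivative F (at (z + t *\<^sub>R e)) (s *\<^sub>R e))) (at t)"
        by (rule has_derivative_compose[where f = "\<lambda>t. z + t *\<^sub>R e" and g = F and f' = "\<lambda>t. t *\<^sub>R e"])
          (use C1_on_has_derivative[OF F, of "z + t *\<^sub>R e"] in \<open>auto intro!: derivative_eq_intros\<close>)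
      then show ?thesis by (simp add: D_def linear_scale[OF lin])
    qed
    have "\<exists>x\<in>{0<..<?t}. norm (?G ?t - ?G 0) \<le> norm ((?t - 0) *\<^sub>R D (z + x *\<^sub>R e))"
      by (rule mvt_general[where f' = "\<lambda>x s. s *\<^sub>R D (z + x *\<^sub>R e)"])
        (use G in \<open>auto intro!: has_derivative_continuous_on[OF has_derivative_at_withinI]\<close>)
    then obtain x where "norm (?G ?t - ?G 0) \<le> norm (?t *\<^sub>R D (z + x *\<^sub>R e))" by auto
    also have "\<dots> \<le> ?t * M" using M(3) by (simp add: divide_right_mono)
    finally have "norm (F (z + ?t *\<^sub>R e) - F z) \<le> ?t * M" by simp
    then have "real (Suc n) * norm (F (z + ?t *\<^sub>R e) - F z) \<le> M" by (simp add: field_simps)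
    then show ?thesis using True by (simp add: H_def inverse_eq_divide del: of_nat_Suc)
  next
    case False
    have "cmod (e /\<^sub>R real (Suc n)) \<le> cmod e"
      by (simp add: field_simps mult_le_cancel_left1 del: of_nat_Suc)
    moreover have "cmod z \<le> cmod (z + e /\<^sub>R real (Suc n)) + cmod (e /\<^sub>R real (Suc n))"
      using norm_triangle_ineq4[of "z + e /\<^sub>R real (Suc n)" "e /\<^sub>R real (Suc n)"] by simp
    moreover have "cmod e \<ge> 0" by simp
    moreover have "R + cmod e < cmod z" using False by simp
    ultimately have "R < cmod z" "R < cmod (z + e /\<^sub>R real (Suc n))" by linarith+
    then show ?thesis using M(1) supp by (simp add: H_def)
  qed
  have "(\<lambda>n. \<integral>z. H n z \<partial>lborel) \<longlonglongrightarrow> (\<integral>z. D z \<partial>lborel)"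
  proof (rule integral_dominated_convergence)
    show "integrable lborel (\<lambda>z::complex. M * indicator (cball 0 (R + cmod e)) z)"
      by (intro integrable_mult_right integrable_real_indicator) (auto intro!: emeasure_bounded_finite[unfolded infinity_ennreal_def])
  qed (use lim bound in auto)
  then have "(\<integral>z. D z \<partial>lborel) = 0"
    unfolding intH by (simp add: LIMSEQ_const_iff)
  then show "(\<integral>z. frechet_derivative F (at z) e \<partial>lborel) = 0" by (simp add: D_def)
  show "integrable lborel (\<lambda>z. frechet_derivative F (at z) e)" using intD by (simp add: D_def)
qed

lemma integral_dbar_eq_0:
  assumes "C1_on UNIV F" "\<And>z. R < cmod z \<Longrightarrow> F z = 0"
  shows "(\<integral>z. dbar F z \<partial>lborel) = 0"
  unfolding dbar_def
  using integrable_frechet_derivative[OF assms] integral_frechet_derivative[OF assms] by simp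

subsection \<open>The Cauchy-Pompeiu formula\<close>

text \<open>The value is \<open>\<pi>\<close>, but it only matters that it is not \<open>0\<close>.\<close>
definition pompeiu_const :: real where
  "pompeiu_const = (\<integral>w. 1 / (1 + (cmod w)\<^sup>2)\<^sup>2 \<partial>lborel)"

lemma integrable_pompeiu_const: "integrable lborel (\<lambda>w::complex. 1 / (1 + (cmod w)\<^sup>2)\<^sup>2)"
proof (rule Bochner_Integration.integrable_bound)
  have "integrable lborel (\<lambda>w::complex. (1 + cmod w) powr (-2 * 2))"
    using nn_integral_cmod_powr_finite[of 2] by (intro integrableI_bounded) auto
  then show "integrable lborel (\<lambda>w::complex. 4 * (1 + cmod w) powr (-2 * 2))"
    by (rule integrable_mult_right)
  have "1 / (1 + r\<^sup>2)\<^sup>2 \<le> 4 * (1 + r) powr (-2 * 2)" if "0 \<le> r" for r :: real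
  proof -
    have "(1 + r)\<^sup>2 \<le> 2 * (1 + r\<^sup>2)"
      using zero_le_power2[of "1 - r"] by (simp add: power2_eq_square algebra_simps)
    then have "((1 + r)\<^sup>2)\<^sup>2 \<le> (2 * (1 + r\<^sup>2))\<^sup>2" by (rule power_mono) simp
    then have "(1 + r) ^ 4 \<le> 4 * (1 + r\<^sup>2)\<^sup>2"
      unfolding power_mult_distrib[of 2] by (simp flip: power_mult)
    moreover have "0 < 1 + r\<^sup>2" by (smt (verit) zero_le_power2)
    ultimately have "1 / (1 + r\<^sup>2)\<^sup>2 \<le> 4 * (1 / (1 + r) ^ 4)"
      using that by (simp add: divide_simps mult.commute)
    moreover have "(1 + r) powr (-2 * 2) = 1 / (1 + r) ^ 4"
      using that by (simp add: powr_minus_divide powr_numeral)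
    ultimately show ?thesis by simp
  qed
  then show "AE w in lborel. norm (1 / (1 + (cmod w)\<^sup>2)\<^sup>2) \<le> norm (4 * (1 + cmod w) powr (-2 * 2))"
    by simp
qed measurable

lemma pompeiu_const_nonzero: "pompeiu_const \<noteq> 0"
proof
  assume "pompeiu_const = 0"
  then have "AE w::complex in lborel. 1 / (1 + (cmod w)\<^sup>2)\<^sup>2 = 0"
    unfolding pompeiu_const_def using integrable_pompeiu_const
    by (subst (asm) integral_nonneg_eq_0_iff_AE) auto
  moreover have "1 + (cmod w)\<^sup>2 \<noteq> 0" for w
    by (smt (verit) zero_le_power2)
  ultimately have "AE w::complex in lborel. False" by simp
  then show False by (subst (asm) AE_iff_null) (auto simp: null_sets_def)
qed

text \<open>Integrate by parts against the smooth kernels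
  \<open>cnj (w - z) / (|w - z|\<^sup>2 + \<epsilon>\<^sup>2)\<close>, whose \<^const>\<open>dbar\<close> is an approximate identity,
  and let \<open>\<epsilon>\<close> tend to \<open>0\<close>.\<close>
theorem cauchy_pompeiu:
  assumes F: "C1_on UNIV F" and supp: "\<And>z. R < cmod z \<Longrightarrow> F z = 0"
  shows "(\<integral>w. dbar F w / (z - w) \<partial>lborel) = 2 * of_real pompeiu_const * F z"
proof -
  define \<epsilon> where "\<epsilon> = (\<lambda>n. 1 / real (Suc n))"
  have \<epsilon>: "\<epsilon> n > 0" "\<epsilon> n \<le> 1" for n by (auto simp: \<epsilon>_def)
  have \<epsilon>0: "\<epsilon> \<longlonglongrightarrow> 0" unfolding \<epsilon>_def using LIMSEQ_inverse_real_of_nat by (simp add: inverse_eq_divide)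
  define c where "c = (\<lambda>n. complex_of_real ((\<epsilon> n)\<^sup>2))"
  \<comment> \<open>This is \<open>|w - z|^2 + \<epsilon>^2\<close>, written with \<open>cnj\<close>
    so that the product rule differentiates it.\<close>
  define q where "q = (\<lambda>n w. (w - z) * cnj (w - z) + c n)"
  have q: "q n w = of_real ((cmod (w - z))\<^sup>2 + (\<epsilon> n)\<^sup>2)" for n w
    by (simp only: q_def c_def of_real_add complex_norm_square)
  have qpos: "(cmod (w - z))\<^sup>2 + (\<epsilon> n)\<^sup>2 > 0" for n w
    using \<epsilon>[of n] by (simp add: add_nonneg_pos)
  have q0: "q n w \<noteq> 0" for n w
    unfolding q of_real_eq_0_iff using qpos[of w n] by (rule less_imp_neq[symmetric])
  define k where "k = (\<lambda>n w. cnj (w - z) / q n w)"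
  define k' where "k' = (\<lambda>n w h. (cnj h * q n w - cnj (w - z) * (h * cnj (w - z) + (w - z) * cnj h)) / (q n w * q n w))"
  have k': "(k n has_derivative k' n w) (at w)" for n w
    unfolding k_def k'_def using q0[of n w] unfolding q_def
    by (auto intro!: derivative_eq_intros simp: field_simps)
  have k_C1: "C1_on UNIV (k n)" for n
  proof (rule C1_onI[OF k'])
    show "continuous_on UNIV (\<lambda>w. k' n w e)" for e
      unfolding k'_def using q0[of n] unfolding q_def by (auto intro!: continuous_intros)
  qed
  \<comment> \<open>In this normalisation \<open>dbar\<close> maps \<open>cnj\<close> to 2 and
    \<open>|w - z|^2\<close> to \<open>2 * (w - z)\<close>, so the quotient rule leaves only
    \<open>2 * c n\<close> in the numerator.\<close>
  have dbar_k: "dbar (k n) w = 2 * c n / (q n w)\<^sup>2" for n w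
    unfolding dbar_eq[OF k'] k'_def using q0[of n w]
    by (simp add: divide_simps power2_eq_square) (simp add: q_def algebra_simps)
  have diff: "F differentiable at w" "k n differentiable at w" for n w
    using F k_C1[of n] by (auto simp: C1_on_def)
  have cF: "continuous_on UNIV F" by (rule C1_on_continuous_on[OF F])
  have cD: "continuous_on UNIV (dbar F)" by (rule C1_on_continuous_on_dbar[OF F])
  have D0: "dbar F w = 0" if "R < cmod w" for w
    using frechet_derivative_support[OF F supp that] by (simp add: dbar_def)
  obtain M where M: "\<And>z. cmod (dbar F z) \<le> M * indicator (cball 0 R) z" "0 < M"
    using continuous_bounded_support[OF cD D0] by blast
  obtain N where N: "\<And>z. cmod (F z) \<le> N" "0 < N"
    using continuous_bounded_support[OF cF supp] by blast
  have [measurable]: "F \<in> borel_measurable borel" "dbar F \<in> borel_measurable borel"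
      "k n \<in> borel_measurable borel" "q n \<in> borel_measurable borel" for n
    using cF cD C1_on_continuous_on[OF k_C1[of n]]
    by (auto intro!: borel_measurable_continuous_onI continuous_intros simp: q_def[abs_def])
  have int: "integrable lborel (\<lambda>w. dbar F w * k n w)" "integrable lborel (\<lambda>w. F w * dbar (k n) w)" for n
  proof -
    have "continuous_on UNIV (\<lambda>w. dbar F w * k n w)" "continuous_on UNIV (\<lambda>w. F w * dbar (k n) w)"
      by (intro continuous_intros cF cD C1_on_continuous_on k_C1 C1_on_continuous_on_dbar)+
    then show "integrable lborel (\<lambda>w. dbar F w * k n w)" "integrable lborel (\<lambda>w. F w * dbar (k n) w)"
      by (auto intro!: integrable_continuous_support[where R = R] simp: D0 supp)
  qed
  have eq: "(\<integral>w. dbar F w * k n w \<partial>lborel) = - (\<integral>w. F w * dbar (k n) w \<partial>lborel)" for n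
  proof -
    have "(\<integral>w. dbar (\<lambda>w. F w * k n w) w \<partial>lborel) = 0"
      by (rule integral_dbar_eq_0[OF C1_on_mult[OF F k_C1]]) (use supp in auto)
    then show ?thesis
      using int[of n] by (simp add: dbar_mult diff add_eq_0_iff)
  qed
  have lim1: "(\<lambda>n. \<integral>w. dbar F w * k n w \<partial>lborel) \<longlonglongrightarrow> (\<integral>w. dbar F w / (w - z) \<partial>lborel)"
  proof (rule integral_dominated_convergence)
    \<comment> \<open>The singularity sits at \<open>z\<close>, so the support in
      \<open>cball 0 R\<close> is enlarged to a disc centred at \<open>z\<close>.\<close>
    show "integrable lborel (\<lambda>w. M * (indicator (cball z (R + cmod z)) w / cmod (w - z)))"
      by (intro integrable_mult_right integrable_inverse_cmod)
    show "AE w in lborel. (\<lambda>n. dbar F w * k n w) \<longlonglongrightarrow> dbar F w / (w - z)"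
    proof (intro always_eventually allI)
      fix w
      show "(\<lambda>n. dbar F w * k n w) \<longlonglongrightarrow> dbar F w / (w - z)"
      \<comment> \<open>At \<open>w = z\<close> both sides are 0, the right one by division by
        zero.\<close>
      proof (cases "w = z")
        case False
        have "(\<lambda>n. dbar F w * (cnj (w - z) / ((w - z) * cnj (w - z) + of_real ((\<epsilon> n)\<^sup>2))))
            \<longlonglongrightarrow> dbar F w * (cnj (w - z) / ((w - z) * cnj (w - z) + of_real (0\<^sup>2)))"
          using False by (intro tendsto_intros \<epsilon>0) auto
        then show ?thesis using False by (simp add: k_def q_def c_def)
      qed (simp add: k_def)
    qed
    show "AE w in lborel. cmod (dbar F w * k n w) \<le> M * (indicator (cball z (R + cmod z)) w / cmod (w - z))" for n
    proof (intro always_eventually allI)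
      fix w
      have 1: "cmod (k n w) \<le> 1 / cmod (w - z)"
      proof (cases "w = z")
        case False
        have "cmod (k n w) = cmod (w - z) / ((cmod (w - z))\<^sup>2 + (\<epsilon> n)\<^sup>2)"
          using qpos[of w n] unfolding k_def norm_divide q norm_of_real by (simp del: complex_cnj_diff)
        also have "\<dots> \<le> cmod (w - z) / (cmod (w - z))\<^sup>2"
          using False qpos[of w n] by (intro divide_left_mono) auto
        finally show ?thesis using False by (simp add: power2_eq_square)
      qed (simp add: k_def)
      have 2: "indicator (cball 0 R) w \<le> (indicator (cball z (R + cmod z)) w :: real)"
        using norm_triangle_ineq4[of z w] by (auto simp: indicator_def dist_norm)
      have "cmod (dbar F w * k n w) \<le> M * indicator (cball z (R + cmod z)) w * (1 / cmod (w - z))"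
        unfolding norm_mult
        by (intro mult_mono order_trans[OF M(1)] 1 mult_left_mono 2) (use M(2) in auto)
      then show "cmod (dbar F w * k n w) \<le> M * (indicator (cball z (R + cmod z)) w / cmod (w - z))" by simp
    qed
  qed measurable
  have lim2: "(\<lambda>n. \<integral>w. F w * dbar (k n) w \<partial>lborel) \<longlonglongrightarrow> 2 * of_real pompeiu_const * F z"
  proof -
    \<comment> \<open>Rescale around \<open>z\<close>: the area factor \<open>\<epsilon>^2\<close>
      and the numerator \<open>2 * \<epsilon>^2\<close> cancel the \<open>\<epsilon>^4\<close> from
      \<open>q^2\<close>, leaving a fixed integrable profile.\<close>
    have "(\<integral>w. F w * dbar (k n) w \<partial>lborel)
        = (\<integral>w. F (z + \<epsilon> n *\<^sub>R w) * of_real (2 * (1 / (1 + (cmod w)\<^sup>2)\<^sup>2)) \<partial>lborel)" for n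
    proof -
      have "(\<integral>w. F w * dbar (k n) w \<partial>lborel) = \<bar>\<epsilon> n\<bar> ^ DIM(complex) *\<^sub>R
          (\<integral>w. F (z + \<epsilon> n *\<^sub>R w) * dbar (k n) (z + \<epsilon> n *\<^sub>R w) \<partial>lborel)"
        unfolding dbar_k using \<epsilon>[of n] by (intro integral_lborel_affine) auto
      also have "\<dots> = (\<integral>w. (\<epsilon> n)\<^sup>2 *\<^sub>R (F (z + \<epsilon> n *\<^sub>R w) * dbar (k n) (z + \<epsilon> n *\<^sub>R w)) \<partial>lborel)"
        by simp
      also have "\<dots> = (\<integral>w. F (z + \<epsilon> n *\<^sub>R w) * of_real (2 * (1 / (1 + (cmod w)\<^sup>2)\<^sup>2)) \<partial>lborel)"
      proof (intro Bochner_Integration.integral_cong refl)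
        fix w
        have "q n (z + \<epsilon> n *\<^sub>R w) = of_real ((\<epsilon> n)\<^sup>2) * of_real (1 + (cmod w)\<^sup>2)"
          unfolding q using \<epsilon>(1)[of n] by (simp add: power_mult_distrib algebra_simps)
        then have "of_real ((\<epsilon> n)\<^sup>2) * dbar (k n) (z + \<epsilon> n *\<^sub>R w) = of_real (2 * (1 / (1 + (cmod w)\<^sup>2)\<^sup>2))"
          using \<epsilon>(1)[of n] by (simp add: dbar_k c_def power_mult_distrib power2_eq_square)
        then show "(\<epsilon> n)\<^sup>2 *\<^sub>R (F (z + \<epsilon> n *\<^sub>R w) * dbar (k n) (z + \<epsilon> n *\<^sub>R w))
            = F (z + \<epsilon> n *\<^sub>R w) * of_real (2 * (1 / (1 + (cmod w)\<^sup>2)\<^sup>2))"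
          by (metis mult.left_commute scaleR_conv_of_real)
      qed
      finally show ?thesis .
    qed
    moreover have "(\<lambda>n. \<integral>w. F (z + \<epsilon> n *\<^sub>R w) * of_real (2 * (1 / (1 + (cmod w)\<^sup>2)\<^sup>2)) \<partial>lborel)
        \<longlonglongrightarrow> (\<integral>w. F z * of_real (2 * (1 / (1 + (cmod w)\<^sup>2)\<^sup>2)) \<partial>lborel)"
    proof (rule integral_dominated_convergence)
      show "integrable lborel (\<lambda>w. N * (2 * (1 / (1 + (cmod w)\<^sup>2)\<^sup>2)))"
        by (intro integrable_mult_right integrable_pompeiu_const)
      show "AE w in lborel. (\<lambda>n. F (z + \<epsilon> n *\<^sub>R w) * of_real (2 * (1 / (1 + (cmod w)\<^sup>2)\<^sup>2)))
          \<longlonglongrightarrow> F z * of_real (2 * (1 / (1 + (cmod w)\<^sup>2)\<^sup>2))"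
      proof (intro always_eventually allI tendsto_mult tendsto_const)
        fix w
        have "(\<lambda>n. z + \<epsilon> n *\<^sub>R w) \<longlonglongrightarrow> z + 0 *\<^sub>R w" by (intro tendsto_intros \<epsilon>0)
        then show "(\<lambda>n. F (z + \<epsilon> n *\<^sub>R w)) \<longlonglongrightarrow> F z"
          using continuous_on_tendsto_compose[OF cF, of _ z] by simp
      qed
      show "AE w in lborel. cmod (F (z + \<epsilon> n *\<^sub>R w) * of_real (2 * (1 / (1 + (cmod w)\<^sup>2)\<^sup>2)))
          \<le> N * (2 * (1 / (1 + (cmod w)\<^sup>2)\<^sup>2))" for n
        unfolding norm_mult norm_of_real using N by (intro always_eventually allI mult_mono) auto
    qed measurable
    moreover have "(\<integral>w. F z * of_real (2 * (1 / (1 + (cmod w)\<^sup>2)\<^sup>2)) \<partial>lborel) = 2 * of_real pompeiu_const * F z"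
      unfolding integral_mult_right_zero integral_complex_of_real pompeiu_const_def by simp
    ultimately show ?thesis by simp
  qed
  have "(\<integral>w. dbar F w / (w - z) \<partial>lborel) = - (2 * of_real pompeiu_const * F z)"
    using LIMSEQ_unique[OF lim1[unfolded eq] tendsto_minus[OF lim2]] .
  moreover have "(\<integral>w. dbar F w / (z - w) \<partial>lborel) = - (\<integral>w. dbar F w / (w - z) \<partial>lborel)"
    by (subst integral_minus[symmetric]) (simp add: minus_divide_right)
  ultimately show ?thesis by simp
qed

subsection \<open>Cauchy transforms\<close>

lemma integrable_divide_diff:
  fixes g :: "complex \<Rightarrow> complex"
  assumes g: "integrable lborel g" and "0 < s" and far: "\<And>w. g w \<noteq> 0 \<Longrightarrow> s \<le> cmod (z - w)"
  shows "integrable lborel (\<lambda>w. g w / (z - w))"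
proof (rule Bochner_Integration.integrable_bound)
  show "integrable lborel (\<lambda>w. cmod (g w) / s)" using g by simp
  show "(\<lambda>w. g w / (z - w)) \<in> borel_measurable lborel"
    using borel_measurable_integrable[OF g] by measurable
  show "AE w in lborel. cmod (g w / (z - w)) \<le> norm (cmod (g w) / s)"
  proof (intro always_eventually allI)
    fix w
    show "cmod (g w / (z - w)) \<le> norm (cmod (g w) / s)"
      using far[of w] \<open>0 < s\<close>
      by (cases "g w = 0") (auto simp: norm_divide intro!: divide_left_mono mult_pos_pos)
  qed
qed

text \<open>Away from the support the kernel is bounded, and differentiation under the integral is
  done in Caratheodory form: the slope is again an integral, whose continuity at \<open>z\<close>
  follows by dominated convergence.\<close>

lemma holomorphic_on_cauchy_transform:
  fixes g :: "complex \<Rightarrow> complex"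
  assumes g: "integrable lborel g" and g0: "\<And>w. w \<in> ball z0 r \<Longrightarrow> g w = 0"
  shows "(\<lambda>z. \<integral>w. g w / (z - w) \<partial>lborel) holomorphic_on ball z0 r"
proof -
  have meas [measurable]: "g \<in> borel_measurable lborel" using g by (rule borel_measurable_integrable)
  have "(\<lambda>z. \<integral>w. g w / (z - w) \<partial>lborel) field_differentiable at z" if z: "z \<in> ball z0 r" for z
  proof -
    \<comment> \<open>Half the remaining distance: every \<open>u\<close> within \<open>s\<close> of
      \<open>z\<close> then stays at distance at least \<open>s\<close> from the support of
      \<open>g\<close>.\<close>
    define s where "s = (r - dist z0 z) / 2"
    have s: "0 < s" using z by (simp add: s_def)
    have far: "s \<le> cmod (u - w)" if "u \<in> ball z s" "g w \<noteq> 0" for u w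
    proof -
      have "r \<le> dist z0 w" using g0[of w] that(2) by (meson mem_ball not_le)
      also have "\<dots> \<le> dist z0 z + dist z u + dist u w" by metric
      finally show ?thesis using that(1) by (simp add: s_def dist_norm)
    qed
    have int: "integrable lborel (\<lambda>w. g w / (u - w))" if "u \<in> ball z s" for u
      using far[OF that] by (rule integrable_divide_diff[OF g s])
    \<comment> \<open>Caratheodory's criterion needs the slope identity for all \<open>u\<close>.
      Only the integral formula near \<open>z\<close> matters; elsewhere the plain quotient makes
      the identity trivial.\<close>
    define h where "h = (\<lambda>u. if u \<in> ball z s then (\<integral>w. - g w / ((z - w) * (u - w)) \<partial>lborel)
        else ((\<integral>w. g w / (u - w) \<partial>lborel) - (\<integral>w. g w / (z - w) \<partial>lborel)) / (u - z))"
    have "(\<integral>w. g w / (u - w) \<partial>lborel) - (\<integral>w. g w / (z - w) \<partial>lborel) = h u * (u - z)" for u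
    proof (cases "u \<in> ball z s")
      case True
      have "(\<integral>w. g w / (u - w) \<partial>lborel) - (\<integral>w. g w / (z - w) \<partial>lborel)
          = (\<integral>w. g w / (u - w) - g w / (z - w) \<partial>lborel)"
        using int[of u] int[of z] True s by simp
      also have "\<dots> = (\<integral>w. (- g w / ((z - w) * (u - w))) * (u - z) \<partial>lborel)"
      proof (intro Bochner_Integration.integral_cong refl)
        fix w
        show "g w / (u - w) - g w / (z - w) = (- g w / ((z - w) * (u - w))) * (u - z)"
        proof (cases "g w = 0")
          case False
          then have "z - w \<noteq> 0" "u - w \<noteq> 0"
            using far[of u w] far[of z w] True s by auto
          then show ?thesis by (simp add: divide_simps) (simp add: algebra_simps)
        qed simp
      qed
      also have "\<dots> = (\<integral>w. - g w / ((z - w) * (u - w)) \<partial>lborel) * (u - z)"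
        by (rule integral_mult_left_zero)
      finally show ?thesis using True by (simp add: h_def)
    next
      case False
      then have "u \<noteq> z" using s by auto
      with False show ?thesis by (simp add: h_def)
    qed
    moreover have "isCont h z"
    proof (rule continuous_at_sequentiallyI)
      \<comment> \<open>The sequence is shifted by \<open>m\<close> so that all its terms lie where
        \<open>h\<close> is given by the integral.\<close>
      fix u assume u: "u \<longlonglongrightarrow> z"
      then obtain m where m: "\<And>n. m \<le> n \<Longrightarrow> u n \<in> ball z s"
        using s topological_tendstoD[OF u, of "ball z s"] by (auto simp: eventually_sequentially)
      have "(\<lambda>n. \<integral>w. - g w / ((z - w) * (u (n + m) - w)) \<partial>lborel) \<longlonglongrightarrow> (\<integral>w. - g w / ((z - w) * (z - w)) \<partial>lborel)"
      proof (rule integral_dominated_convergence)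
        show "integrable lborel (\<lambda>w. cmod (g w) / (s * s))" using g by simp
        show "AE w in lborel. (\<lambda>n. - g w / ((z - w) * (u (n + m) - w))) \<longlonglongrightarrow> - g w / ((z - w) * (z - w))"
        proof (intro always_eventually allI)
          fix w
          show "(\<lambda>n. - g w / ((z - w) * (u (n + m) - w))) \<longlonglongrightarrow> - g w / ((z - w) * (z - w))"
          proof (cases "g w = 0")
            case False
            then have "z - w \<noteq> 0" using far[of z w] s by auto
            then show ?thesis
              by (intro tendsto_intros LIMSEQ_ignore_initial_segment u) auto
          qed simp
        qed
        show "AE w in lborel. cmod (- g w / ((z - w) * (u (n + m) - w))) \<le> cmod (g w) / (s * s)" for n
        proof (intro always_eventually allI)
          fix w
          show "cmod (- g w / ((z - w) * (u (n + m) - w))) \<le> cmod (g w) / (s * s)"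
          proof (cases "g w = 0")
            case False
            then have "s \<le> cmod (z - w)" "s \<le> cmod (u (n + m) - w)"
              using far[of z w] far[of "u (n + m)" w] m[of "n + m"] s by auto
            then have "s * s \<le> cmod (z - w) * cmod (u (n + m) - w)" using s by (intro mult_mono) auto
            moreover have "0 < s * s" using s by simp
            ultimately show ?thesis
              unfolding norm_divide norm_mult norm_minus_cancel
              by (intro divide_left_mono) auto
          qed simp
        qed
      qed measurable
      then have "(\<lambda>n. h (u (n + m))) \<longlonglongrightarrow> h z" using m s by (simp add: h_def)
      then show "(\<lambda>n. h (u n)) \<longlonglongrightarrow> h z" by (rule LIMSEQ_offset)
    qed
    ultimately have "((\<lambda>z. \<integral>w. g w / (z - w) \<partial>lborel) has_field_derivative h z) (at z)"
      unfolding DERIV_caratheodory_within by blast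
    then show ?thesis by (auto simp: field_differentiable_def)
  qed
  then show ?thesis
    by (simp add: holomorphic_on_open field_differentiable_def)
qed

subsection \<open>Cutoff functions\<close>

text \<open>Squaring makes the positive part continuously differentiable across 0.\<close>

definition sq_pos :: "real \<Rightarrow> real" where "sq_pos t = (max 0 t)\<^sup>2"

lemma sq_pos_deriv: "(sq_pos has_real_derivative 2 * max 0 t) (at t)"
proof -
  consider "t < 0" | "t = 0" | "t > 0" by linarith
  then show ?thesis
  proof cases
    case 1
    show ?thesis
      by (rule has_field_derivative_transform_within_open[of "\<lambda>_. 0" _ _ "{..<0}"])
        (use 1 in \<open>auto simp: sq_pos_def\<close>)
  next
    case 3
    show ?thesis
      by (rule has_field_derivative_transform_within_open[of "\<lambda>t. t\<^sup>2" _ _ "{0<..}"])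
        (use 3 in \<open>auto simp: sq_pos_def intro!: derivative_eq_intros\<close>)
  next
    case 2
    \<comment> \<open>At the junction, \<open>sq_pos t = max 0 t * t\<close> exhibits
      \<open>max 0\<close> as the continuous slope.\<close>
    have "(sq_pos has_real_derivative 0) (at 0)"
      unfolding DERIV_caratheodory_within
      by (rule exI[of _ "max 0"]) (auto simp: sq_pos_def max_def power2_eq_square intro!: continuous_intros)
    with 2 show ?thesis by simp
  qed
qed

text \<open>The denominator is positive because \<open>t\<close> and \<open>1 - t\<close> are never
  both nonpositive. The step is exactly constant outside the unit interval, which makes the
  derivative of a cutoff vanish there and not merely become small.\<close>

definition step_fun :: "real \<Rightarrow> real" where
  "step_fun t = sq_pos t / (sq_pos t + sq_pos (1 - t))"

lemma sq_pos_sum_pos: "0 < sq_pos t + sq_pos (1 - t)"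
  by (cases "0 < t") (auto simp: sq_pos_def max_def add_pos_nonneg add_nonneg_pos)

lemma step_fun_0: "t \<le> 0 \<Longrightarrow> step_fun t = 0"
  and step_fun_1: "1 \<le> t \<Longrightarrow> step_fun t = 1"
  and step_fun_nonneg: "0 \<le> step_fun t"
  and step_fun_le_1: "step_fun t \<le> 1"
  using sq_pos_sum_pos[of t]
  by (auto simp: step_fun_def sq_pos_def max_def field_simps)

lemma step_fun_C1:
  obtains s' where "\<And>t. (step_fun has_real_derivative s' t) (at t)" "continuous_on UNIV s'"
proof -
  define N where "N = (\<lambda>t. sq_pos t + sq_pos (1 - t))"
  have N: "N t \<noteq> 0" for t using sq_pos_sum_pos[of t] by (simp add: N_def)
  have cs: "continuous_on S (\<lambda>x. sq_pos (f x))" if "continuous_on S f" for S and f :: "real \<Rightarrow> real"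
    unfolding sq_pos_def using that by (intro continuous_intros)
  define s' where "s' = (\<lambda>t. ((2 * max 0 t) * N t - sq_pos t * (2 * max 0 t + 2 * max 0 (1 - t) * (0 - 1))) / (N t * N t))"
  have "(N has_real_derivative (2 * max 0 t + 2 * max 0 (1 - t) * (0 - 1))) (at t)" for t
    unfolding N_def
    by (intro derivative_intros sq_pos_deriv DERIV_chain2[OF sq_pos_deriv])
  then have "((\<lambda>t. sq_pos t / N t) has_real_derivative s' t) (at t)" for t
    unfolding s'_def using N[of t]
    by (intro DERIV_divide sq_pos_deriv) auto
  then have "(step_fun has_real_derivative s' t) (at t)" for t
    by (simp add: step_fun_def[abs_def] N_def)
  moreover have "continuous_on UNIV s'"
    unfolding s'_def using N unfolding N_def by (intro continuous_intros cs) auto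
  ultimately show ?thesis by (rule that)
qed

lemma real_polynomial_function_C1:
  fixes p :: "complex \<Rightarrow> real"
  assumes "real_polynomial_function p"
  shows "\<exists>p'. (\<forall>z. (p has_derivative p' z) (at z)) \<and> (\<forall>e. continuous_on UNIV (\<lambda>z. p' z e))"
  using assms
proof induction
  case (linear f)
  then show ?case
    by (intro exI[of _ "\<lambda>_. f"]) (auto intro: bounded_linear_imp_has_derivative)
next
  case (const c)
  show ?case by (intro exI[of _ "\<lambda>_ _. 0"]) auto
next
  case (add f g)
  then obtain f' g' where "\<And>z. (f has_derivative f' z) (at z)" "\<And>z. (g has_derivative g' z) (at z)"
    "\<And>e. continuous_on UNIV (\<lambda>z. f' z e)" "\<And>e. continuous_on UNIV (\<lambda>z. g' z e)" by metis
  then show ?case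
    by (intro exI[of _ "\<lambda>z h. f' z h + g' z h"]) (auto intro!: derivative_intros continuous_intros)
next
  case (mult f g)
  then obtain f' g' where D: "\<And>z. (f has_derivative f' z) (at z)" "\<And>z. (g has_derivative g' z) (at z)"
    "\<And>e. continuous_on UNIV (\<lambda>z. f' z e)" "\<And>e. continuous_on UNIV (\<lambda>z. g' z e)" by metis
  have "continuous_on UNIV f" "continuous_on UNIV g"
    using D by (auto intro!: has_derivative_continuous_on)
  with D show ?case
    by (intro exI[of _ "\<lambda>z h. f z * g' z h + f' z h * g z"])
      (auto intro!: derivative_intros continuous_intros)
qed

text \<open>The distance function is only Lipschitz; a polynomial near it is smooth, and the step
  removes the approximation error by flattening both ends. Outside \<open>cball 0 R\<close> the
  polynomial is uncontrolled, but the step still keeps the values between 0 and 1.\<close>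

lemma cutoff_exists:
  assumes "0 < d" and AB: "\<And>a b. a \<in> A \<Longrightarrow> b \<in> B \<Longrightarrow> d \<le> cmod (a - b)" and "B \<noteq> {}"
  obtains \<phi> where "C1_on UNIV \<phi>" "\<And>z. cmod (\<phi> z) \<le> 1" "\<And>z. cmod (1 - \<phi> z) \<le> 1"
    "\<And>a z. a \<in> A \<Longrightarrow> cmod (a - z) < d / 4 \<Longrightarrow> cmod z \<le> R \<Longrightarrow> \<phi> z = 0"
    "\<And>b z. b \<in> B \<Longrightarrow> cmod (b - z) < d / 4 \<Longrightarrow> cmod z \<le> R \<Longrightarrow> \<phi> z = 1"
proof -
  \<comment> \<open>The affine scaling leaves room for an error below 1/2: near \<open>A\<close> the
    distance to \<open>B\<close> is at least \<open>3 * d / 4\<close>, so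
    \<open>\<psi> \<le> -1\<close>; near \<open>B\<close> it is below \<open>d / 4\<close>, so
    \<open>\<psi> > 1\<close>. Hence \<open>p + 1/2\<close> falls below 0 or above 1.\<close>
  define \<psi> where "\<psi> = (\<lambda>z. 2 - 4 * infdist z B / d)"
  have c\<psi>: "continuous_on (cball 0 R) \<psi>" unfolding \<psi>_def by (intro continuous_intros) (use \<open>0 < d\<close> in auto)
  obtain p where p: "real_polynomial_function p" "\<And>z. z \<in> cball 0 R \<Longrightarrow> \<bar>\<psi> z - p z\<bar> < 1/2"
    by (rule Stone_Weierstrass_real_polynomial_function[OF compact_cball c\<psi>, of "1/2"]) simp_all
  obtain p' where p': "\<And>z. (p has_derivative p' z) (at z)" "\<And>e. continuous_on UNIV (\<lambda>z. p' z e)"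
    using real_polynomial_function_C1[OF p(1)] by blast
  obtain s' where s': "\<And>t. (step_fun has_real_derivative s' t) (at t)" "continuous_on UNIV s'"
    using step_fun_C1 by blast
  define \<phi> where "\<phi> = (\<lambda>z. complex_of_real (step_fun (p z + 1/2)))"
  show ?thesis
  proof
    have cp: "continuous_on UNIV p" using p'(1) by (auto intro!: has_derivative_continuous_on)
    show "C1_on UNIV \<phi>"
    proof (rule C1_onI)
      fix z
      have "((\<lambda>z. p z + 1/2) has_derivative p' z) (at z)"
        using p'(1)[of z] by (auto intro!: derivative_eq_intros)
      from has_derivative_compose[OF this, of step_fun "\<lambda>h. s' (p z + 1/2) * h"] s'(1)[of "p z + 1/2"]
      have "((\<lambda>z. step_fun (p z + 1/2)) has_derivative (\<lambda>h. s' (p z + 1/2) * p' z h)) (at z)"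
        by (simp add: has_field_derivative_def)
      then show "(\<phi> has_derivative (\<lambda>h. of_real (s' (p z + 1/2) * p' z h))) (at z)"
        unfolding \<phi>_def by (rule has_derivative_of_real)
    next
      fix e
      show "continuous_on UNIV (\<lambda>z. complex_of_real (s' (p z + 1/2) * p' z e))"
        by (intro continuous_intros p'(2) continuous_on_compose2[OF s'(2)] cp) auto
    qed
    show "cmod (\<phi> z) \<le> 1" for z using step_fun_nonneg step_fun_le_1 by (simp add: \<phi>_def)
    show "cmod (1 - \<phi> z) \<le> 1" for z
    proof -
      have "1 - \<phi> z = of_real (1 - step_fun (p z + 1/2))" by (simp add: \<phi>_def)
      then show ?thesis
        using step_fun_nonneg[of "p z + 1/2"] step_fun_le_1[of "p z + 1/2"] by (simp only: norm_of_real)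
    qed
    show "\<phi> z = 0" if "a \<in> A" "cmod (a - z) < d / 4" "cmod z \<le> R" for a z
    proof -
      have "3 * d / 4 \<le> infdist z B"
      proof (rule cInf_greatest[of "dist z ` B", folded infdist_notempty[OF \<open>B \<noteq> {}\<close>]])
        fix x assume "x \<in> dist z ` B"
        then obtain b where b: "b \<in> B" "x = cmod (z - b)" by (auto simp: dist_norm)
        have "d \<le> cmod (a - b)" using AB that(1) b(1) by blast
        also have "\<dots> \<le> cmod (a - z) + cmod (z - b)"
          using norm_triangle_ineq[of "a - z" "z - b"] by simp
        finally show "3 * d / 4 \<le> x" using that(2) b(2) by simp
      qed (use \<open>B \<noteq> {}\<close> in auto)
      then have "\<psi> z \<le> -1" using \<open>0 < d\<close> by (simp add: \<psi>_def field_simps)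
      with p(2)[of z] that(3) have "p z + 1/2 \<le> 0" by (auto simp: abs_if split: if_splits)
      then show ?thesis by (simp add: \<phi>_def step_fun_0)
    qed
    show "\<phi> z = 1" if "b \<in> B" "cmod (b - z) < d / 4" "cmod z \<le> R" for b z
    proof -
      have "infdist z B < d / 4"
        using infdist_le[OF that(1), of z] that(2) by (simp add: dist_norm norm_minus_commute)
      then have "1 < \<psi> z" using \<open>0 < d\<close> by (simp add: \<psi>_def field_simps)
      with p(2)[of z] that(3) have "1 \<le> p z + 1/2" by (auto simp: abs_if split: if_splits)
      then show ?thesis by (simp add: \<phi>_def step_fun_1)
    qed
  qed
qed

subsection \<open>Correcting a product with a cutoff\<close>

lemma holomorphic_on_locally:
  assumes "\<And>z. z \<in> S \<Longrightarrow> \<exists>T. open T \<and> z \<in> T \<and> f holomorphic_on T"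
  shows "f holomorphic_on S"
  unfolding holomorphic_on_def
proof
  fix z assume "z \<in> S"
  then obtain T where "open T" "z \<in> T" "f holomorphic_on T" using assms by blast
  then show "f field_differentiable at z within S"
    by (meson field_differentiable_at_within holomorphic_on_imp_differentiable_at)
qed

text \<open>Here \<open>z\<close> may lie in the support: a bounded numerator meets a locally
  integrable singularity.\<close>

lemma integrable_continuous_divide_diff:
  fixes f :: "complex \<Rightarrow> complex"
  assumes f: "continuous_on UNIV f" and R: "\<And>z. R < cmod z \<Longrightarrow> f z = 0"
  shows "integrable lborel (\<lambda>w. f w / (z - w))"
proof -
  obtain M where M: "\<And>z. cmod (f z) \<le> M * indicator (cball 0 R) z" "0 < M"
    using continuous_bounded_support[OF f R] by metis
  have [measurable]: "f \<in> borel_measurable borel"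
    using f by (rule borel_measurable_continuous_onI)
  show ?thesis
  proof (rule Bochner_Integration.integrable_bound)
    show "integrable lborel (\<lambda>w. M * (indicator (cball z (R + cmod z)) w / cmod (w - z)))"
      by (intro integrable_mult_right integrable_inverse_cmod)
    show "AE w in lborel. cmod (f w / (z - w)) \<le> norm (M * (indicator (cball z (R + cmod z)) w / cmod (w - z)))"
    proof (intro always_eventually allI)
      fix w
      have "indicator (cball 0 R) w \<le> (indicator (cball z (R + cmod z)) w :: real)"
        using norm_triangle_ineq4[of z w] by (auto simp: indicator_def dist_norm)
      then have "cmod (f w) \<le> M * indicator (cball z (R + cmod z)) w"
        using M(2) by (intro order_trans[OF M(1)] mult_left_mono) auto
      then show "cmod (f w / (z - w)) \<le> norm (M * (indicator (cball z (R + cmod z)) w / cmod (w - z)))"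
        using M(2) by (simp add: norm_divide norm_minus_commute divide_right_mono)
    qed
  qed measurable
qed

text \<open>Localisation: for a cutoff \<open>\<eta>\<close> equal to 1 near \<open>z0\<close>,
  \<open>F = \<eta> * h * \<phi>\<close> is \<open>C^1\<close> on the plane, and by Cauchy-Pompeiu
  the difference in question is near \<open>z0\<close> the transform of \<open>dbar F - g\<close>.
  That density vanishes near \<open>z0\<close>, since there
  \<open>dbar F = h * dbar \<phi> = g\<close>.\<close>

lemma holomorphic_on_cutoff_minus_transform:
  assumes W: "open W" and h: "h holomorphic_on W" and \<phi>: "C1_on UNIV \<phi>"
    and g_def: "g = (\<lambda>w. if w \<in> W then h w * dbar \<phi> w else 0)" and g: "integrable lborel g"
  shows "(\<lambda>z. 2 * of_real pompeiu_const * (h z * \<phi> z) - (\<integral>w. g w / (z - w) \<partial>lborel)) holomorphic_on W"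
proof (rule holomorphic_on_locally)
  fix z0 assume z0: "z0 \<in> W"
  then obtain e where e: "0 < e" "ball z0 e \<subseteq> W"
    using openE[OF W] by blast
  \<comment> \<open>Nested discs: \<open>\<eta>\<close> is 1 within \<open>r / 2\<close>, from
    \<open>d = 2 * r\<close> in \<open>cutoff_exists\<close>, and 0 outside radius
    \<open>2 * r\<close>; \<open>h\<close> is available up to \<open>3 * r\<close>, and the overlap
    lets \<open>F\<close> be glued with 0.\<close>
  define r where "r = e / 3"
  have r: "0 < r" "ball z0 (3 * r) \<subseteq> W"
    using e by (simp_all add: r_def)
  define R where "R = cmod z0 + 3 * r"
  have ball_R: "cmod z < R" if "z \<in> ball z0 (3 * r)" for z
    using that norm_triangle_ineq2[of z z0] by (simp add: R_def dist_norm norm_minus_commute)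
  have sep: "2 * r \<le> cmod (a - b)" if "a \<in> - ball z0 (2 * r)" "b \<in> {z0}" for a b
    using that by (auto simp: dist_norm norm_minus_commute)
  obtain \<eta> where \<eta>: "C1_on UNIV \<eta>" "\<And>z. cmod (\<eta> z) \<le> 1" "\<And>z. cmod (1 - \<eta> z) \<le> 1"
      "\<And>a z. a \<in> - ball z0 (2 * r) \<Longrightarrow> cmod (a - z) < 2 * r / 4 \<Longrightarrow> cmod z \<le> R \<Longrightarrow> \<eta> z = 0"
      "\<And>b z. b \<in> {z0} \<Longrightarrow> cmod (b - z) < 2 * r / 4 \<Longrightarrow> cmod z \<le> R \<Longrightarrow> \<eta> z = 1"
  proof (rule cutoff_exists[where A = "- ball z0 (2 * r)" and B = "{z0}" and R = R])
    show "0 < 2 * r" using r(1) by simp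
    show "2 * r \<le> cmod (a - b)" if "a \<in> - ball z0 (2 * r)" "b \<in> {z0}" for a b
      using that by (rule sep)
  qed (simp, rule that)
  define F where "F = (\<lambda>z. if z \<in> ball z0 (3 * r) then \<eta> z * (h z * \<phi> z) else 0)"
  have hol: "h holomorphic_on ball z0 (3 * r)" using h r(2) by (rule holomorphic_on_subset)
  have F: "C1_on UNIV F"
  proof -
    have "C1_on (ball z0 (3 * r)) F"
    proof (rule C1_on_cong)
      show "C1_on (ball z0 (3 * r)) (\<lambda>z. \<eta> z * (h z * \<phi> z))"
        by (intro C1_on_mult C1_on_holomorphic hol C1_on_subset[OF \<eta>(1)] C1_on_subset[OF \<phi>]) auto
    qed (auto simp: F_def)
    moreover have "C1_on (- cball z0 (2 * r)) F"
    proof (rule C1_on_cong[OF _ C1_on_const[of _ 0]])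
      fix z assume z: "z \<in> - cball z0 (2 * r)"
      have "\<eta> z = 0" if "z \<in> ball z0 (3 * r)"
        using \<eta>(4)[of z z] z ball_R[OF that] r(1) by auto
      then show "0 = F z" by (simp add: F_def)
    qed auto
    moreover have "ball z0 (3 * r) \<union> - cball z0 (2 * r) = UNIV" using r(1) by auto
    ultimately show ?thesis
      using C1_on_Un[of "ball z0 (3 * r)" "- cball z0 (2 * r)" F] by auto
  qed
  have F0: "F z = 0" if "R < cmod z" for z
    using ball_R[of z] that by (auto simp: F_def)
  have dF0: "dbar F z = 0" if "R < cmod z" for z
    using frechet_derivative_support[OF F F0 that] by (simp add: dbar_def)
  have cD: "continuous_on UNIV (dbar F)" by (rule C1_on_continuous_on_dbar[OF F])
  have near: "F z = h z * \<phi> z" if "z \<in> ball z0 (r / 2)" for z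
  proof -
    have "z \<in> ball z0 (3 * r)" using that r(1) by auto
    with \<eta>(5)[of z0 z] ball_R[of z] that show ?thesis
      by (simp add: F_def dist_norm)
  qed
  define G where "G = (\<lambda>w. dbar F w - g w)"
  have G: "integrable lborel G"
    unfolding G_def by (intro Bochner_Integration.integrable_diff g integrable_continuous_support[OF cD dF0])
  have G0: "G w = 0" if "w \<in> ball z0 (r / 2)" for w
  proof -
    have "dbar F w = dbar (\<lambda>z. h z * \<phi> z) w"
      by (rule dbar_cong[OF _ that near]) auto
    also have "\<dots> = h w * dbar \<phi> w + dbar h w * \<phi> w"
    proof (rule dbar_mult)
      show "h differentiable at w"
        using C1_on_holomorphic[OF _ hol] that r(1) by (auto simp: C1_on_def)
      show "\<phi> differentiable at w" using \<phi> by (auto simp: C1_on_def)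
    qed
    also have "dbar h w = 0"
      by (rule dbar_holomorphic[OF _ hol]) (use that r(1) in auto)
    moreover have "w \<in> W" using that r by force
    ultimately show ?thesis by (simp add: G_def g_def)
  qed
  have "2 * of_real pompeiu_const * (h z * \<phi> z) - (\<integral>w. g w / (z - w) \<partial>lborel) = (\<integral>w. G w / (z - w) \<partial>lborel)"
    if z: "z \<in> ball z0 (r / 2)" for z
  proof -
    define s where "s = r / 2 - dist z0 z"
    have "0 < s" using z by (simp add: s_def)
    moreover have "s \<le> cmod (z - w)" if "G w \<noteq> 0" for w
    proof -
      have "r / 2 \<le> dist z0 w" using G0[of w] that by (meson mem_ball not_le)
      also have "\<dots> \<le> dist z0 z + dist z w" by metric
      finally show ?thesis by (simp add: s_def dist_norm)
    qed
    ultimately have 1: "integrable lborel (\<lambda>w. G w / (z - w))"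
      by (rule integrable_divide_diff[OF G])
    have 2: "integrable lborel (\<lambda>w. dbar F w / (z - w))"
      by (rule integrable_continuous_divide_diff[OF cD dF0])
    \<comment> \<open>Integrability of \<open>g w / (z - w)\<close> is not known beforehand; it is
      written as a difference of two functions already known to be integrable.\<close>
    have "(\<integral>w. g w / (z - w) \<partial>lborel) = (\<integral>w. dbar F w / (z - w) - G w / (z - w) \<partial>lborel)"
      by (intro Bochner_Integration.integral_cong refl) (simp add: G_def diff_divide_distrib)
    also have "\<dots> = 2 * of_real pompeiu_const * (h z * \<phi> z) - (\<integral>w. G w / (z - w) \<partial>lborel)"
      using 1 2 cauchy_pompeiu[OF F F0, where z = z] near[OF z] by simp
    finally show ?thesis by simp
  qed
  then have "(\<lambda>z. 2 * of_real pompeiu_const * (h z * \<phi> z) - (\<integral>w. g w / (z - w) \<partial>lborel)) holomorphic_on ball z0 (r / 2)"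
    by (intro holomorphic_transform[OF holomorphic_on_cauchy_transform[OF G G0]]) simp_all
  then show "\<exists>T. open T \<and> z0 \<in> T \<and>
      (\<lambda>z. 2 * of_real pompeiu_const * (h z * \<phi> z) - (\<integral>w. g w / (z - w) \<partial>lborel)) holomorphic_on T"
    using r(1) by (intro exI[of _ "ball z0 (r / 2)"]) auto
qed

subsection \<open>Bounds for Cauchy transforms in \<open>L\<^sup>p\<close>\<close>

lemma add_powr_le:
  fixes x y :: real
  assumes "0 \<le> x" "0 \<le> y" "0 < p"
  shows "(x + y) powr p \<le> 2 powr p * (x powr p + y powr p)"
proof -
  have "(x + y) powr p \<le> (2 * max x y) powr p" using assms by (intro powr_mono2) auto
  also have "\<dots> = 2 powr p * max x y powr p" using assms by (simp add: powr_mult)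
  also have "max x y powr p \<le> x powr p + y powr p" by (auto simp: max_def)
  finally show ?thesis by simp
qed

lemma le_one_add_powr:
  fixes x p :: real
  assumes "0 \<le> x" "1 \<le> p"
  shows "x \<le> 1 + x powr p"
proof (cases "x \<le> 1")
  case False
  then have "x powr 1 \<le> x powr p" using assms by (intro powr_mono) auto
  with False show ?thesis by simp
qed (simp add: add_increasing2)

text \<open>Substitute for the Hoelder inequality: \<open>x \<le> t + t\<^sup>1\<^sup>-\<^sup>p x\<^sup>p\<close> turns an
  \<open>L\<^sup>1\<close> bound into an \<open>L\<^sup>p\<close> bound after optimising over \<open>t\<close>.\<close>
lemma le_add_powr_mult:
  fixes x t p :: real
  assumes "0 \<le> x" "0 < t" "1 \<le> p"
  shows "x \<le> t + t powr (1 - p) * x powr p"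
proof (cases "x \<le> t")
  case False
  then have "x = x powr (1 - p) * x powr p"
    using assms by (simp flip: powr_add)
  also have "\<dots> \<le> t powr (1 - p) * x powr p"
    using assms False by (intro mult_right_mono powr_mono2') auto
  finally show ?thesis using assms by simp
qed (use assms in \<open>simp add: add_increasing2\<close>)

text \<open>For a non-integrable \<open>f\<close> the left side is 0, the default value of the
  Bochner integral.\<close>

lemma norm_integral_le_nn_integral:
  fixes f :: "'a \<Rightarrow> complex"
  shows "ennreal (cmod (integral\<^sup>L M f)) \<le> (\<integral>\<^sup>+x. ennreal (cmod (f x)) \<partial>M)"
  by (cases "integrable M f") (auto simp: integral_norm_bound_ennreal not_integrable_integral_eq)

text \<open>On the support \<open>x \<le> 1 + x powr p\<close>, and the constant 1 is integrable
  over a disc.\<close>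

lemma integrable_of_powr:
  fixes G :: "complex \<Rightarrow> complex"
  assumes G [measurable]: "G \<in> borel_measurable borel" and "1 \<le> p"
    and supp: "\<And>w. R < cmod w \<Longrightarrow> G w = 0"
    and fin: "(\<integral>\<^sup>+w. ennreal (cmod (G w) powr p) \<partial>lborel) < \<infinity>"
  shows "integrable lborel G"
proof (rule integrableI_bounded)
  have "(\<integral>\<^sup>+w. ennreal (cmod (G w)) \<partial>lborel) \<le>
      (\<integral>\<^sup>+w. indicator (cball 0 R) w + ennreal (cmod (G w) powr p) \<partial>lborel)"
  proof (rule nn_integral_mono)
    fix w
    show "ennreal (cmod (G w)) \<le> indicator (cball 0 R) w + ennreal (cmod (G w) powr p)"
    proof (cases "R < cmod w")
      case False
      then show ?thesis
        using le_one_add_powr[of "cmod (G w)" p] \<open>1 \<le> p\<close>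
        by (simp add: ennreal_leI flip: ennreal_1 ennreal_plus)
    qed (simp add: supp)
  qed
  also have "\<dots> = emeasure lborel (cball 0 R :: complex set) + (\<integral>\<^sup>+w. ennreal (cmod (G w) powr p) \<partial>lborel)"
    by (subst nn_integral_add) (auto intro!: borel_measurable_indicator)
  also have "\<dots> < \<infinity>"
    using fin emeasure_bounded_finite[of "cball 0 R :: complex set"] by simp
  finally show "(\<integral>\<^sup>+w. ennreal (cmod (G w)) \<partial>lborel) < \<infinity>" .
qed simp

text \<open>On a large disc this is a Young-type inequality: the truncated kernel has the same
  finite mass around every point, and Tonelli integrates \<open>|G|^p\<close> against it. Outside,
  both \<open>C z\<close> and \<open>1 / (z - a)\<close> decay like \<open>1 / |z|\<close>, and
  \<open>|z| powr (-2 * p)\<close> is integrable at infinity as \<open>p > 1\<close>. Excluding a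
  disc around \<open>a\<close> keeps the divisor away from 0.\<close>

lemma nn_integral_cauchy_transform_powr:
  fixes G :: "complex \<Rightarrow> complex"
  assumes G [measurable]: "G \<in> borel_measurable borel" and p: "1 < p"
    and supp: "\<And>w. R < cmod w \<Longrightarrow> G w = 0"
    and fin: "(\<integral>\<^sup>+w. ennreal (cmod (G w) powr p) \<partial>lborel) < \<infinity>" and \<rho>: "0 < \<rho>"
  shows "(\<integral>\<^sup>+z\<in>- ball a \<rho>. ennreal (cmod ((\<integral>w. G w / (z - w) \<partial>lborel) / (z - a)) powr p) \<partial>lborel) < \<infinity>"
proof -
  define C where "C = (\<lambda>z. \<integral>w. G w / (z - w) \<partial>lborel)"
  define L where "L = (\<integral>w. cmod (G w) \<partial>lborel)"
  have intG: "integrable lborel G" by (rule integrable_of_powr[OF G _ supp fin]) (use p in auto)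
  have L0: "0 \<le> L" by (simp add: L_def)
  \<comment> \<open>Beyond radius \<open>S\<close>, \<open>|z|\<close> exceeds 1 and twice both
    \<open>|R|\<close> and \<open>|a|\<close>, so \<open>|z - w|\<close> on the support and
    \<open>|z - a|\<close> are at least \<open>|z| / 2\<close>.\<close>
  define S where "S = 2 * \<bar>R\<bar> + 2 * cmod a + 1"
  \<comment> \<open>The truncation radius covers every pair with \<open>|z| \<le> S\<close> and
    \<open>|w| \<le> R\<close>. It is symmetric in \<open>z\<close> and \<open>w\<close>, so one
    mass \<open>K\<close> bounds the kernel in either variable.\<close>
  define k where "k = (\<lambda>z w. indicator (cball z (\<bar>R\<bar> + S)) w / cmod (w - z))"
  have k0: "0 \<le> k z w" for z w by (simp add: k_def)
  have ksym: "k z w = k w z" for z w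
    by (simp add: k_def indicator_def dist_commute norm_minus_commute)
  have k_meas: "(\<lambda>(z, w). k z w) \<in> borel_measurable (lborel \<Otimes>\<^sub>M lborel)"
  proof -
    have "(\<lambda>(z, w). k z w) = (\<lambda>x::complex \<times> complex. (if dist (fst x) (snd x) \<le> \<bar>R\<bar> + S then 1 else 0) / cmod (snd x - fst x))"
      by (auto simp: k_def indicator_def)
    also have "\<dots> \<in> borel_measurable (borel \<Otimes>\<^sub>M borel)" by measurable
    finally show ?thesis by (simp cong: measurable_cong_sets add: sets_pair_measure_cong[OF sets_lborel sets_lborel])
  qed
  have k_meas1 [measurable]: "k z \<in> borel_measurable borel" for z
    unfolding k_def by (intro borel_measurable_divide borel_measurable_indicator; measurable)
  define K where "K = enn2real (\<integral>\<^sup>+w. ennreal (indicator (cball 0 (\<bar>R\<bar> + S)) w / cmod w) \<partial>lborel)"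
  have K0: "0 \<le> K" by (simp add: K_def)
  have K: "(\<integral>\<^sup>+w. ennreal (k z w) \<partial>lborel) = ennreal K" for z
    unfolding k_def K_def nn_integral_inverse_cmod_shift
    by (rule ennreal_enn2real[symmetric, OF nn_integral_inverse_cmod_finite[unfolded infinity_ennreal_def]])
  define I where "I = (\<lambda>z. \<integral>\<^sup>+w. ennreal (cmod (G w) powr p * k z w) \<partial>lborel)"
  have I_meas2: "(\<lambda>(z, w). ennreal (cmod (G w) powr p * k z w)) \<in> borel_measurable (lborel \<Otimes>\<^sub>M lborel)"
  proof -
    have "(\<lambda>x. ennreal (cmod (G (snd x)) powr p * (\<lambda>(z, w). k z w) x)) \<in> borel_measurable (lborel \<Otimes>\<^sub>M lborel)"
      by (intro measurable_compose[OF _ measurable_ennreal] borel_measurable_times k_meas) measurable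
    then show ?thesis by (simp add: case_prod_beta')
  qed
  have I_meas [measurable]: "I \<in> borel_measurable lborel"
    using lborel.borel_measurable_nn_integral[OF I_meas2] by (simp add: I_def)
  have int_I: "(\<integral>\<^sup>+z. I z \<partial>lborel) < \<infinity>"
  proof -
    have "(\<integral>\<^sup>+z. I z \<partial>lborel) = (\<integral>\<^sup>+w. (\<integral>\<^sup>+z. ennreal (cmod (G w) powr p * k z w) \<partial>lborel) \<partial>lborel)"
      unfolding I_def by (rule lborel_pair.Fubini'[symmetric, OF I_meas2])
    also have "\<dots> = (\<integral>\<^sup>+w. ennreal (cmod (G w) powr p) * ennreal K \<partial>lborel)"
    proof (rule nn_integral_cong)
      fix w
      have "(\<integral>\<^sup>+z. ennreal (cmod (G w) powr p * k z w) \<partial>lborel)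
          = (\<integral>\<^sup>+z. ennreal (cmod (G w) powr p) * ennreal (k w z) \<partial>lborel)"
        by (intro nn_integral_cong) (simp add: ennreal_mult k0 ksym[of _ w])
      also have "\<dots> = ennreal (cmod (G w) powr p) * ennreal K"
        by (subst nn_integral_cmult) (auto simp: K)
      finally show "(\<integral>\<^sup>+z. ennreal (cmod (G w) powr p * k z w) \<partial>lborel) = ennreal (cmod (G w) powr p) * ennreal K" .
    qed
    also have "\<dots> = (\<integral>\<^sup>+w. ennreal (cmod (G w) powr p) \<partial>lborel) * ennreal K"
      by (rule nn_integral_multc) measurable
    also have "\<dots> < \<infinity>" using fin by (simp add: ennreal_mult_less_top)
    finally show ?thesis .
  qed
  have near: "ennreal (cmod (C z) powr p) \<le> ennreal ((K + 1) powr p) * (1 + I z)" if z: "cmod z \<le> S" for z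
  proof (cases "I z")
    \<comment> \<open>The factor \<open>(K + 1) powr p\<close> is positive, so the right side is
      infinite as well.\<close>
    case top
    then show ?thesis using K0 by (simp add: ennreal_mult_top)
  next
    case (real i)
    \<comment> \<open>Balances the two terms of \<open>le_add_powr_mult\<close>; the added 1 keeps
      \<open>t\<close> positive when \<open>i = 0\<close>.\<close>
    define t where "t = (1 + i) powr (1 / p)"
    have t: "0 < t" using real(1) by (simp add: t_def)
    have tp: "t powr p = 1 + i" using real(1) p by (simp add: t_def powr_powr)
    have "ennreal (cmod (C z)) \<le> (\<integral>\<^sup>+w. ennreal (cmod (G w / (z - w))) \<partial>lborel)"
      unfolding C_def by (rule norm_integral_le_nn_integral)
    also have "\<dots> \<le> (\<integral>\<^sup>+w. ennreal t * ennreal (k z w) + ennreal (t powr (1 - p)) * ennreal (cmod (G w) powr p * k z w) \<partial>lborel)"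
    proof (rule nn_integral_mono)
      fix w
      have "cmod (G w / (z - w)) \<le> cmod (G w) * k z w"
      proof (cases "R < cmod w")
        case True then show ?thesis by (simp add: supp)
      next
        case False
        then have "w \<in> cball z (\<bar>R\<bar> + S)"
          using z norm_triangle_ineq4[of z w] by (simp add: dist_norm)
        then show ?thesis by (simp add: k_def norm_divide norm_minus_commute)
      qed
      also have "\<dots> \<le> (t + t powr (1 - p) * cmod (G w) powr p) * k z w"
        using t p k0 by (intro mult_right_mono le_add_powr_mult) auto
      also have "\<dots> = t * k z w + t powr (1 - p) * (cmod (G w) powr p * k z w)"
        by (simp add: algebra_simps)
      finally show "ennreal (cmod (G w / (z - w))) \<le> ennreal t * ennreal (k z w) + ennreal (t powr (1 - p)) * ennreal (cmod (G w) powr p * k z w)"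
        using t k0[of z w] by (simp add: ennreal_leI flip: ennreal_mult ennreal_plus)
    qed
    also have "\<dots> = ennreal t * ennreal K + ennreal (t powr (1 - p)) * ennreal i"
      using real(2) unfolding I_def by (simp add: nn_integral_add nn_integral_cmult K)
    also have "\<dots> = ennreal (t * K + t powr (1 - p) * i)"
      using t K0 real(1) by (simp add: ennreal_mult)
    finally have "cmod (C z) \<le> t * K + t powr (1 - p) * i"
      using t K0 real(1) by (subst (asm) ennreal_le_iff) auto
    \<comment> \<open>Uses \<open>i \<le> 1 + i = t powr p\<close>, so both terms become multiples
      of \<open>t\<close>.\<close>
    also have "t powr (1 - p) * i \<le> t powr (1 - p) * t powr p"
      unfolding tp by (intro mult_left_mono) auto
    also have "\<dots> = t" using t by (simp flip: powr_add)
    finally have "cmod (C z) \<le> (K + 1) * t" by (simp add: algebra_simps)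
    then have "cmod (C z) powr p \<le> ((K + 1) * t) powr p" using p by (intro powr_mono2) auto
    also have "\<dots> = (K + 1) powr p * (1 + i)" using K0 t tp by (simp add: powr_mult)
    finally show ?thesis using real K0
      by (simp add: ennreal_leI flip: ennreal_mult ennreal_plus ennreal_1)
  qed
  have far: "cmod (C z / (z - a)) powr p \<le> (16 * L) powr p * (1 + cmod z) powr (-2 * p)" if z: "S < cmod z" for z
  proof -
    have z1: "1 < cmod z" "2 * \<bar>R\<bar> < cmod z" "2 * cmod a < cmod z"
      using z norm_ge_zero[of a] abs_ge_zero[of R] unfolding S_def by linarith+
    have "cmod (C z) \<le> (\<integral>w. cmod (G w / (z - w)) \<partial>lborel)"
      unfolding C_def by (rule integral_norm_bound)
    also have "\<dots> \<le> (\<integral>w. cmod (G w) * (2 / cmod z) \<partial>lborel)"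
    proof (rule integral_mono')
      fix w
      show "cmod (G w / (z - w)) \<le> cmod (G w) * (2 / cmod z)"
      proof (cases "R < cmod w")
        case True then show ?thesis by (simp add: supp)
      next
        case False
        then have "cmod z / 2 \<le> cmod (z - w)"
          using z1 norm_triangle_ineq2[of z w] by simp
        then have "1 / cmod (z - w) \<le> 1 / (cmod z / 2)"
          using z1 by (intro divide_left_mono mult_pos_pos) auto
        then show ?thesis
          by (simp add: norm_divide) (metis mult_left_mono norm_ge_zero times_divide_eq_right mult.right_neutral)
      qed
    qed (use intG in auto)
    also have "\<dots> = L * (2 / cmod z)" by (simp add: L_def)
    finally have 1: "cmod (C z) \<le> L * (2 / cmod z)" .
    have "cmod z / 2 \<le> cmod (z - a)" using z1 norm_triangle_ineq2[of z a] by simp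
    then have "1 / cmod (z - a) \<le> 1 / (cmod z / 2)"
      using z1 by (intro divide_left_mono mult_pos_pos) auto
    then have 2: "1 / cmod (z - a) \<le> 2 / cmod z" by simp
    \<comment> \<open>From \<open>1 < |z|\<close>. This factor 4, once for \<open>C z\<close> and
      once for \<open>1 / (z - a)\<close>, produces the constant 16.\<close>
    have "4 / (2 * cmod z) \<le> 4 / (1 + cmod z)"
      by (rule divide_left_mono) (use z1 in \<open>auto intro!: mult_pos_pos\<close>)
    then have 3: "2 / cmod z \<le> 4 / (1 + cmod z)" by simp
    have "cmod (C z / (z - a)) = cmod (C z) * (1 / cmod (z - a))" by (simp add: norm_divide)
    also have "\<dots> \<le> (L * (4 / (1 + cmod z))) * (4 / (1 + cmod z))"
      using L0 by (intro mult_mono order_trans[OF 1] order_trans[OF 2] 3 mult_left_mono) auto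
    also have "\<dots> = (16 * L) * (1 + cmod z) powr (-2)"
      by (simp add: powr_minus_divide power2_eq_square add_pos_nonneg)
    finally have "cmod (C z / (z - a)) powr p \<le> ((16 * L) * (1 + cmod z) powr (-2)) powr p"
      using p by (intro powr_mono2) auto
    then show ?thesis using L0 by (simp add: powr_mult powr_powr)
  qed
  define c where "c = (1 / \<rho>) powr p * (K + 1) powr p"
  have "(\<integral>\<^sup>+z\<in>- ball a \<rho>. ennreal (cmod (C z / (z - a)) powr p) \<partial>lborel)
      \<le> (\<integral>\<^sup>+z. (ennreal c * (indicator (cball 0 S) z + I z)) + ennreal ((16 * L) powr p) * ennreal ((1 + cmod z) powr (-2 * p)) \<partial>lborel)"
  proof (rule nn_integral_mono)
    fix z
    show "ennreal (cmod (C z / (z - a)) powr p) * indicator (- ball a \<rho>) z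
        \<le> (ennreal c * (indicator (cball 0 S) z + I z)) + ennreal ((16 * L) powr p) * ennreal ((1 + cmod z) powr (-2 * p))"
    proof (cases "z \<in> ball a \<rho>")
      case False
      then have za: "\<rho> \<le> cmod (z - a)" by (simp add: dist_norm norm_minus_commute)
      show ?thesis
      proof (cases "cmod z \<le> S")
        case True
        have "cmod (C z / (z - a)) \<le> (1 / \<rho>) * cmod (C z)"
          using za \<rho> by (simp add: norm_divide frac_le)
        then have "cmod (C z / (z - a)) powr p \<le> ((1 / \<rho>) * cmod (C z)) powr p"
          using p by (intro powr_mono2) auto
        also have "\<dots> = (1 / \<rho>) powr p * cmod (C z) powr p" using \<rho> by (simp only: powr_mult)
        finally have "ennreal (cmod (C z / (z - a)) powr p) \<le> ennreal ((1 / \<rho>) powr p) * ennreal (cmod (C z) powr p)"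
          by (simp add: ennreal_leI flip: ennreal_mult)
        also have "\<dots> \<le> ennreal ((1 / \<rho>) powr p) * (ennreal ((K + 1) powr p) * (1 + I z))"
          by (intro mult_left_mono near True) auto
        also have "\<dots> = ennreal c * (indicator (cball 0 S) z + I z)"
          using True by (simp add: c_def ennreal_mult mult.assoc)
        finally show ?thesis using False by (simp add: add_increasing2)
      next
        case Fa: False
        have "ennreal (cmod (C z / (z - a)) powr p) \<le> ennreal ((16 * L) powr p) * ennreal ((1 + cmod z) powr (-2 * p))"
          using far[of z] Fa by (simp add: ennreal_leI flip: ennreal_mult)
        then show ?thesis using False by (simp add: add_increasing)
      qed
    qed simp
  qed
  also have "\<dots> = ennreal c * (emeasure lborel (cball 0 S :: complex set) + (\<integral>\<^sup>+z. I z \<partial>lborel))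
      + ennreal ((16 * L) powr p) * (\<integral>\<^sup>+z. ennreal ((1 + cmod z) powr (-2 * p)) \<partial>lborel)"
  proof -
    have [measurable]: "(indicator (cball 0 S) :: complex \<Rightarrow> ennreal) \<in> borel_measurable lborel"
      by (rule borel_measurable_indicator) simp
    show ?thesis
      by (simp add: nn_integral_add nn_integral_cmult)
  qed
  also have "\<dots> < \<infinity>"
    using int_I nn_integral_cmod_powr_finite[OF p] emeasure_bounded_finite[of "cball 0 S :: complex set"]
    by (simp add: ennreal_mult_less_top)
  finally show ?thesis by (simp add: C_def)
qed

subsection \<open>Decomposition of Bergman functions\<close>

lemma borel_measurable_if_continuous_on:
  fixes f :: "complex \<Rightarrow> complex"
  assumes "open W" "continuous_on W f"
  shows "(\<lambda>z. if z \<in> W then f z else 0) \<in> borel_measurable borel"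
proof -
  have "(\<lambda>z. indicator W z *\<^sub>R f z) \<in> borel_measurable borel"
    using assms by (intro borel_measurable_continuous_on_indicator) auto
  also have "(\<lambda>z. indicator W z *\<^sub>R f z) = (\<lambda>z. if z \<in> W then f z else 0)"
    by (auto simp: indicator_def)
  finally show ?thesis .
qed

text \<open>A solution of \<open>dbar u = f \<cdot> dbar \<phi>\<close>. Compared with the plain Cauchy transform, the factor
  \<open>(w - a) / (z - a)\<close> improves the decay at infinity from \<open>1 / |z|\<close> to \<open>1 / |z|\<^sup>2\<close>, which is
  \<open>L\<^sup>p\<close> for every \<open>p > 1\<close>.\<close>
definition dbar_correction :: "complex set \<Rightarrow> complex \<Rightarrow> (complex \<Rightarrow> complex) \<Rightarrow> (complex \<Rightarrow> complex) \<Rightarrow> complex \<Rightarrow> complex" where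
  "dbar_correction W a f \<phi> z = (\<integral>w. (if w \<in> W then (w - a) * f w * dbar \<phi> w else 0) / (z - w) \<partial>lborel)
     / (z - a) / (2 * of_real pompeiu_const)"

text \<open>Stated for one set \<open>\<Omega>\<close> so that it serves twice, with
  \<open>\<phi>\<close> on the first set and \<open>1 - \<phi>\<close> on the second. The condition
  \<open>near\<close> makes the extension by zero, and the density, vanish around points of
  \<open>\<Omega>\<close> outside \<open>W\<close>.\<close>

lemma cutoff_minus_dbar_correction:
  assumes p: "1 < p" and W: "open W" "W \<subseteq> cball 0 R" "W \<subseteq> \<Omega>" and \<Omega>: "open \<Omega>" "\<Omega> \<inter> ball a \<rho> = {}" "0 < \<rho>"
    and f: "f holomorphic_on W" and fin: "(\<integral>\<^sup>+z\<in>W. ennreal (cmod (f z) powr p) \<partial>lborel) < \<infinity>"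
    and \<phi>: "C1_on UNIV \<phi>" "\<And>z. cmod (\<phi> z) \<le> 1"
    and near: "\<forall>z0\<in>\<Omega> - W. \<exists>r>0. \<forall>z\<in>W \<inter> ball z0 r. \<phi> z = 0"
  defines "F \<equiv> \<lambda>z. (if z \<in> W then \<phi> z * f z else 0) - dbar_correction W a f \<phi> z"
  shows "F holomorphic_on \<Omega>" and "(\<integral>\<^sup>+z\<in>\<Omega>. ennreal (cmod (F z) powr p) \<partial>lborel) < \<infinity>"
proof -
  define G where "G = (\<lambda>w. if w \<in> W then (w - a) * f w * dbar \<phi> w else 0)"
  define U where "U = (\<lambda>z. \<integral>w. G w / (z - w) \<partial>lborel)"
  have T: "dbar_correction W a f \<phi> z = U z / (z - a) / (2 * of_real pompeiu_const)" for z
    by (simp add: dbar_correction_def U_def G_def)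
  have cf: "continuous_on W f" using f by (rule holomorphic_on_imp_continuous_on)
  have cD: "continuous_on UNIV (dbar \<phi>)" by (rule C1_on_continuous_on_dbar[OF \<phi>(1)])
  have [measurable]: "G \<in> borel_measurable borel"
    unfolding G_def using continuous_on_subset[OF cD, of W]
    by (intro borel_measurable_if_continuous_on W continuous_intros cf) auto
  have supp: "G w = 0" if "R < cmod w" for w using W(2) that by (auto simp: G_def)
  have fW [measurable]: "(\<lambda>z. if z \<in> W then f z else 0) \<in> borel_measurable borel"
    by (intro borel_measurable_if_continuous_on W cf)
  have fin': "(\<integral>\<^sup>+z. ennreal (cmod (if z \<in> W then f z else 0) powr p) \<partial>lborel) < \<infinity>"
  proof -
    have "(\<integral>\<^sup>+z. ennreal (cmod (if z \<in> W then f z else 0) powr p) \<partial>lborel)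
        = (\<integral>\<^sup>+z\<in>W. ennreal (cmod (f z) powr p) \<partial>lborel)"
      using p by (intro nn_integral_cong) (auto simp: indicator_def)
    then show ?thesis using fin by simp
  qed
  have finG: "(\<integral>\<^sup>+z. ennreal (cmod (G z) powr p) \<partial>lborel) < \<infinity>"
  proof -
    \<comment> \<open>Since \<open>W\<close> lies in a disc, compactness bounds the continuous
      factor of \<open>f\<close> in \<open>G\<close>, so \<open>G\<close> inherits the
      \<open>L^p\<close> bound.\<close>
    have "bounded ((\<lambda>w. (w - a) * dbar \<phi> w) ` cball 0 R)"
      by (intro compact_imp_bounded compact_continuous_image continuous_intros continuous_on_subset[OF cD]) auto
    then obtain M where M: "0 < M" "\<And>w. w \<in> cball 0 R \<Longrightarrow> cmod ((w - a) * dbar \<phi> w) \<le> M"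
      by (auto simp: bounded_pos)
    have "(\<integral>\<^sup>+z. ennreal (cmod (G z) powr p) \<partial>lborel)
        \<le> (\<integral>\<^sup>+z. ennreal (M powr p) * ennreal (cmod (if z \<in> W then f z else 0) powr p) \<partial>lborel)"
    proof (rule nn_integral_mono)
      fix z
      have "cmod (G z) \<le> M * cmod (if z \<in> W then f z else 0)"
      proof (cases "z \<in> W")
        case True
        have "cmod (G z) = cmod ((z - a) * dbar \<phi> z) * cmod (f z)"
          using True by (simp add: G_def norm_mult)
        also have "\<dots> \<le> M * cmod (f z)" using True W(2) by (intro mult_right_mono M(2)) auto
        finally show ?thesis using True by simp
      qed (simp add: G_def)
      then have "cmod (G z) powr p \<le> (M * cmod (if z \<in> W then f z else 0)) powr p"
        using p by (intro powr_mono2) auto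
      also have "\<dots> = M powr p * cmod (if z \<in> W then f z else 0) powr p"
        using M(1) by (simp only: powr_mult)
      finally show "ennreal (cmod (G z) powr p) \<le> ennreal (M powr p) * ennreal (cmod (if z \<in> W then f z else 0) powr p)"
        by (simp only: ennreal_leI ennreal_mult[symmetric] powr_ge_zero)
    qed
    also have "\<dots> = ennreal (M powr p) * (\<integral>\<^sup>+z. ennreal (cmod (if z \<in> W then f z else 0) powr p) \<partial>lborel)"
      by (rule nn_integral_cmult) measurable
    also have "\<dots> < \<infinity>" using fin' by (simp only: ennreal_mult_less_top infinity_ennreal_def) auto
    finally show ?thesis .
  qed
  have intG: "integrable lborel G"
    by (rule integrable_of_powr[OF _ _ supp finG]) (use p in auto)
  have a: "z \<noteq> a" if "z \<in> \<Omega>" for z using \<Omega>(2,3) that by (metis IntI centre_in_ball empty_iff)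
  show "F holomorphic_on \<Omega>"
  proof (rule holomorphic_on_locally)
    fix z0 assume z0: "z0 \<in> \<Omega>"
    show "\<exists>T. open T \<and> z0 \<in> T \<and> F holomorphic_on T"
    proof (cases "z0 \<in> W")
      case True
      \<comment> \<open>The kernel factor \<open>w - a\<close> is holomorphic, so it is absorbed
        into \<open>h = (z - a) * f\<close>; the later division by \<open>z - a\<close> restores
        \<open>\<phi> * f\<close>.\<close>
      have *: "(\<lambda>z. 2 * of_real pompeiu_const * (((z - a) * f z) * \<phi> z) - U z) holomorphic_on W"
        unfolding U_def
        by (rule holomorphic_on_cutoff_minus_transform[OF W(1) _ \<phi>(1) _ intG])
          (auto intro!: holomorphic_intros f simp: G_def)
      have "(\<lambda>z. (2 * of_real pompeiu_const * (((z - a) * f z) * \<phi> z) - U z)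
          / (z - a) / (2 * of_real pompeiu_const)) holomorphic_on W"
        by (rule holomorphic_on_divide[OF holomorphic_on_divide[OF *]])
          (use a W(3) pompeiu_const_nonzero in \<open>auto intro!: holomorphic_intros\<close>)
      then have "F holomorphic_on W"
      proof (rule holomorphic_transform)
        fix z assume z: "z \<in> W"
        then have "z - a \<noteq> 0" using a W(3) by auto
        with z show "(2 * of_real pompeiu_const * (((z - a) * f z) * \<phi> z) - U z)
          / (z - a) / (2 * of_real pompeiu_const) = F z"
          using pompeiu_const_nonzero by (simp add: F_def T diff_divide_distrib)
      qed
      with True W(1) show ?thesis by blast
    next
      case False
      with z0 obtain r where r: "0 < r" "\<And>z. z \<in> W \<Longrightarrow> z \<in> ball z0 r \<Longrightarrow> \<phi> z = 0"
        using near by blast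
      have G0: "G w = 0" if "w \<in> ball z0 r" for w
      proof (cases "w \<in> W")
        case True
        \<comment> \<open>The cutoff is identically 0 on the open set
          \<open>W \<inter> ball z0 r\<close>, hence so is its \<open>dbar\<close>.\<close>
        have "dbar \<phi> w = dbar (\<lambda>_. 0) w"
          by (rule dbar_cong[of "W \<inter> ball z0 r"]) (use True that W(1) r(2) in auto)
        then show ?thesis by (simp add: G_def)
      qed (simp add: G_def)
      have "U holomorphic_on ball z0 r"
        unfolding U_def by (rule holomorphic_on_cauchy_transform[OF intG G0])
      then have "(\<lambda>z. - (U z / (z - a) / (2 * of_real pompeiu_const))) holomorphic_on \<Omega> \<inter> ball z0 r"
        using a pompeiu_const_nonzero by (intro holomorphic_intros) (auto elim: holomorphic_on_subset)
      then have "F holomorphic_on \<Omega> \<inter> ball z0 r"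
        by (rule holomorphic_transform) (auto simp: F_def T r(2))
      with z0 r(1) \<Omega>(1) show ?thesis by (intro exI[of _ "\<Omega> \<inter> ball z0 r"]) auto
    qed
  qed
  define c where "c = (1 / cmod (2 * of_real pompeiu_const)) powr p"
  have [measurable]: "U \<in> borel_measurable lborel"
  proof -
    have "(\<lambda>(z, w). G w / (z - w)) \<in> borel_measurable (lborel \<Otimes>\<^sub>M lborel)"
      by measurable
    from lborel.borel_measurable_lebesgue_integral[OF this] show ?thesis by (simp add: U_def)
  qed
  have "(\<integral>\<^sup>+z\<in>\<Omega>. ennreal (cmod (F z) powr p) \<partial>lborel)
      \<le> (\<integral>\<^sup>+z. ennreal (2 powr p) * (ennreal (cmod (if z \<in> W then f z else 0) powr p)
          + ennreal c * (ennreal (cmod (U z / (z - a)) powr p) * indicator (- ball a \<rho>) z)) \<partial>lborel)"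
  proof (rule nn_integral_mono)
    fix z
    let ?f = "if z \<in> W then f z else 0"
    show "ennreal (cmod (F z) powr p) * indicator \<Omega> z \<le> ennreal (2 powr p) * (ennreal (cmod ?f powr p)
          + ennreal c * (ennreal (cmod (U z / (z - a)) powr p) * indicator (- ball a \<rho>) z))"
    proof (cases "z \<in> \<Omega>")
      case True
      have "F z = \<phi> z * ?f - U z / (z - a) / (2 * of_real pompeiu_const)" by (simp add: F_def T)
      then have "cmod (F z) \<le> cmod (\<phi> z * ?f) + cmod (U z / (z - a) / (2 * of_real pompeiu_const))"
        by (simp only: norm_triangle_ineq4)
      also have "\<dots> \<le> cmod ?f + cmod (U z / (z - a)) * (1 / cmod (2 * of_real pompeiu_const))"
        using mult_right_mono[OF \<phi>(2)[of z], of "cmod ?f"] by (simp only: norm_mult norm_divide) simp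
      finally have "cmod (F z) powr p \<le> (cmod ?f + cmod (U z / (z - a)) * (1 / cmod (2 * of_real pompeiu_const))) powr p"
        using p by (intro powr_mono2) auto
      also have "\<dots> \<le> 2 powr p * (cmod ?f powr p + (cmod (U z / (z - a)) * (1 / cmod (2 * of_real pompeiu_const))) powr p)"
        using p by (intro add_powr_le) auto
      also have "(cmod (U z / (z - a)) * (1 / cmod (2 * of_real pompeiu_const))) powr p = c * cmod (U z / (z - a)) powr p"
        unfolding c_def by (subst powr_mult) auto
      finally have "ennreal (cmod (F z) powr p) \<le> ennreal (2 powr p * (cmod ?f powr p + c * cmod (U z / (z - a)) powr p))"
        by (rule ennreal_leI)
      also have "\<dots> = ennreal (2 powr p) * (ennreal (cmod ?f powr p) + ennreal c * ennreal (cmod (U z / (z - a)) powr p))"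
        by (simp only: c_def ennreal_mult ennreal_plus powr_ge_zero mult_nonneg_nonneg add_nonneg_nonneg)
      also have "z \<in> - ball a \<rho>" using True \<Omega>(2) by auto
      then have "ennreal (cmod (U z / (z - a)) powr p) = ennreal (cmod (U z / (z - a)) powr p) * indicator (- ball a \<rho>) z"
        by simp
      finally show ?thesis using True by simp
    qed simp
  qed
  also have "\<dots> = ennreal (2 powr p) * ((\<integral>\<^sup>+z. ennreal (cmod (if z \<in> W then f z else 0) powr p) \<partial>lborel)
      + ennreal c * (\<integral>\<^sup>+z\<in>- ball a \<rho>. ennreal (cmod (U z / (z - a)) powr p) \<partial>lborel))"
    by (subst nn_integral_cmult, measurable, subst nn_integral_add, measurable, subst nn_integral_cmult, measurable)
  also have "\<dots> < \<infinity>"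
    using fin' nn_integral_cauchy_transform_powr[OF _ p supp finG \<Omega>(3), where a = a]
    by (simp only: ennreal_mult_less_top ennreal_add_less_top U_def infinity_ennreal_def) auto
  finally show "(\<integral>\<^sup>+z\<in>\<Omega>. ennreal (cmod (F z) powr p) \<partial>lborel) < \<infinity>" .
qed

section \<open>The two inclusions between the Bergman spaces\<close>

lemma bergman_space_restrict:
  assumes "f holomorphic_on \<Omega>" "(\<integral>\<^sup>+z\<in>\<Omega>. ennreal (cmod (f z) powr p) \<partial>lborel) < \<infinity>"
  shows "restrict f \<Omega> \<in> bergman_space p \<Omega>"
proof -
  have "(\<integral>\<^sup>+z\<in>\<Omega>. ennreal (cmod (restrict f \<Omega> z) powr p) \<partial>lborel) = (\<integral>\<^sup>+z\<in>\<Omega>. ennreal (cmod (f z) powr p) \<partial>lborel)"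
    by (intro nn_integral_cong) (auto simp: indicator_def)
  moreover have "restrict f \<Omega> holomorphic_on \<Omega>"
    using assms(1) by (rule holomorphic_transform) auto
  ultimately show ?thesis using assms(2) by (simp add: bergman_space_def)
qed

lemma bergman_space_zero: "restrict (\<lambda>_. 0) \<Omega> \<in> bergman_space p \<Omega>"
  by (intro bergman_space_restrict) auto

lemma bergman_sumI:
  assumes "f \<in> extensional (\<Omega>\<^sub>1 \<inter> \<Omega>\<^sub>2)" "g \<in> bergman_space p \<Omega>\<^sub>1" "h \<in> bergman_space p \<Omega>\<^sub>2"
    and "\<And>z. z \<in> \<Omega>\<^sub>1 \<inter> \<Omega>\<^sub>2 \<Longrightarrow> f z = g z + h z"
  shows "f \<in> bergman_sum p \<Omega>\<^sub>1 \<Omega>\<^sub>2"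
proof -
  have "f = (\<lambda>z\<in>\<Omega>\<^sub>1 \<inter> \<Omega>\<^sub>2. g z + h z)"
    using assms(1,4) by (intro extensionalityI[of _ "\<Omega>\<^sub>1 \<inter> \<Omega>\<^sub>2"]) auto
  with assms(2,3) show ?thesis unfolding bergman_sum_def by blast
qed

lemma bergman_sum_subset:
  assumes p: "1 < p" and o: "open \<Omega>\<^sub>1" "open \<Omega>\<^sub>2"
  shows "bergman_sum p \<Omega>\<^sub>1 \<Omega>\<^sub>2 \<subseteq> bergman_space p (\<Omega>\<^sub>1 \<inter> \<Omega>\<^sub>2)"
proof
  fix f assume "f \<in> bergman_sum p \<Omega>\<^sub>1 \<Omega>\<^sub>2"
  then obtain g h where f: "f = (\<lambda>z\<in>\<Omega>\<^sub>1 \<inter> \<Omega>\<^sub>2. g z + h z)"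
      and g: "g holomorphic_on \<Omega>\<^sub>1" "(\<integral>\<^sup>+z\<in>\<Omega>\<^sub>1. ennreal (cmod (g z) powr p) \<partial>lborel) < \<infinity>"
      and h: "h holomorphic_on \<Omega>\<^sub>2" "(\<integral>\<^sup>+z\<in>\<Omega>\<^sub>2. ennreal (cmod (h z) powr p) \<partial>lborel) < \<infinity>"
    by (auto simp: bergman_sum_def bergman_space_def)
  have m: "(\<lambda>z. ennreal (cmod (u z) powr p) * indicator \<Omega> z) \<in> borel_measurable lborel"
    if "open \<Omega>" "u holomorphic_on \<Omega>" for u \<Omega>
  proof -
    have [measurable]: "(\<lambda>z. if z \<in> \<Omega> then u z else 0) \<in> borel_measurable borel"
      using that by (intro borel_measurable_if_continuous_on holomorphic_on_imp_continuous_on)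
    have "(\<lambda>z. ennreal (cmod (if z \<in> \<Omega> then u z else 0) powr p)) \<in> borel_measurable lborel" by measurable
    also have "(\<lambda>z. ennreal (cmod (if z \<in> \<Omega> then u z else 0) powr p)) = (\<lambda>z. ennreal (cmod (u z) powr p) * indicator \<Omega> z)"
      using p by (auto simp: indicator_def)
    finally show ?thesis .
  qed
  show "f \<in> bergman_space p (\<Omega>\<^sub>1 \<inter> \<Omega>\<^sub>2)"
    unfolding f
  proof (rule bergman_space_restrict)
    show "(\<lambda>z. g z + h z) holomorphic_on \<Omega>\<^sub>1 \<inter> \<Omega>\<^sub>2"
      using g(1) h(1) by (intro holomorphic_intros) (auto elim: holomorphic_on_subset)
    have "(\<integral>\<^sup>+z\<in>\<Omega>\<^sub>1 \<inter> \<Omega>\<^sub>2. ennreal (cmod (g z + h z) powr p) \<partial>lborel)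
        \<le> (\<integral>\<^sup>+z. ennreal (2 powr p) * (ennreal (cmod (g z) powr p) * indicator \<Omega>\<^sub>1 z
            + ennreal (cmod (h z) powr p) * indicator \<Omega>\<^sub>2 z) \<partial>lborel)"
    proof (rule nn_integral_mono)
      fix z
      have "cmod (g z + h z) powr p \<le> (cmod (g z) + cmod (h z)) powr p"
        using p by (intro powr_mono2 norm_triangle_ineq) auto
      also have "\<dots> \<le> 2 powr p * (cmod (g z) powr p + cmod (h z) powr p)"
        using p by (intro add_powr_le) auto
      finally have "ennreal (cmod (g z + h z) powr p) \<le> ennreal (2 powr p * (cmod (g z) powr p + cmod (h z) powr p))"
        by (rule ennreal_leI)
      then show "ennreal (cmod (g z + h z) powr p) * indicator (\<Omega>\<^sub>1 \<inter> \<Omega>\<^sub>2) z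
          \<le> ennreal (2 powr p) * (ennreal (cmod (g z) powr p) * indicator \<Omega>\<^sub>1 z
            + ennreal (cmod (h z) powr p) * indicator \<Omega>\<^sub>2 z)"
        by (auto simp: indicator_def ennreal_mult)
    qed
    also have "\<dots> = ennreal (2 powr p) * ((\<integral>\<^sup>+z\<in>\<Omega>\<^sub>1. ennreal (cmod (g z) powr p) \<partial>lborel)
        + (\<integral>\<^sup>+z\<in>\<Omega>\<^sub>2. ennreal (cmod (h z) powr p) \<partial>lborel))"
      using m[OF o(1) g(1)] m[OF o(2) h(1)]
      by (subst nn_integral_cmult) (auto simp: nn_integral_add)
    also have "\<dots> < \<infinity>" using g(2) h(2) by (simp add: ennreal_mult_less_top)
    finally show "(\<integral>\<^sup>+z\<in>\<Omega>\<^sub>1 \<inter> \<Omega>\<^sub>2. ennreal (cmod (g z + h z) powr p) \<partial>lborel) < \<infinity>" .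
  qed
qed

lemma set_distance_pos:
  assumes "set_distance A B > 0"
  obtains d where "0 < d" "\<And>a b. a \<in> A \<Longrightarrow> b \<in> B \<Longrightarrow> d \<le> cmod (a - b)"
proof -
  \<comment> \<open>A value strictly below the distance is finite even when the distance is
    infinite.\<close>
  obtain e where e: "0 < e" "e < set_distance A B" using dense[OF assms] by blast
  then obtain d where d: "e = ereal d" by (cases e) auto
  have "d \<le> cmod (a - b)" if "a \<in> A" "b \<in> B" for a b
  proof -
    have "set_distance A B \<le> ereal (cmod (a - b))"
      unfolding set_distance_def by (intro INF_lower2[OF that(1)] INF_lower[OF that(2)])
    from less_le_trans[OF e(2) this] d show ?thesis by simp
  qed
  with e(1) d show ?thesis by (intro that) auto
qed

text \<open>Both differences are nonempty here because the cutoff is built from the distance to one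
  of them, and \<open>infdist\<close> to the empty set is 0.\<close>

lemma bergman_space_subset:
  assumes p: "1 < p" and o: "open \<Omega>\<^sub>1" "open \<Omega>\<^sub>2"
    and d: "0 < d" "\<And>a b. a \<in> \<Omega>\<^sub>1 - \<Omega>\<^sub>2 \<Longrightarrow> b \<in> \<Omega>\<^sub>2 - \<Omega>\<^sub>1 \<Longrightarrow> d \<le> cmod (a - b)"
    and ne: "\<Omega>\<^sub>1 - \<Omega>\<^sub>2 \<noteq> {}" "\<Omega>\<^sub>2 - \<Omega>\<^sub>1 \<noteq> {}"
    and R: "\<Omega>\<^sub>1 \<inter> \<Omega>\<^sub>2 \<subseteq> cball 0 R"
    and a: "(\<Omega>\<^sub>1 \<union> \<Omega>\<^sub>2) \<inter> ball a \<rho> = {}" "0 < \<rho>"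
  shows "bergman_space p (\<Omega>\<^sub>1 \<inter> \<Omega>\<^sub>2) \<subseteq> bergman_sum p \<Omega>\<^sub>1 \<Omega>\<^sub>2"
proof
  let ?W = "\<Omega>\<^sub>1 \<inter> \<Omega>\<^sub>2"
  fix f assume "f \<in> bergman_space p ?W"
  then have f: "f \<in> extensional ?W" "f holomorphic_on ?W" "(\<integral>\<^sup>+z\<in>?W. ennreal (cmod (f z) powr p) \<partial>lborel) < \<infinity>"
    by (auto simp: bergman_space_def)
  obtain \<phi> where \<phi>: "C1_on UNIV \<phi>" "\<And>z. cmod (\<phi> z) \<le> 1" "\<And>z. cmod (1 - \<phi> z) \<le> 1"
    "\<And>a z. a \<in> \<Omega>\<^sub>1 - \<Omega>\<^sub>2 \<Longrightarrow> cmod (a - z) < d / 4 \<Longrightarrow> cmod z \<le> R \<Longrightarrow> \<phi> z = 0"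
    "\<And>b z. b \<in> \<Omega>\<^sub>2 - \<Omega>\<^sub>1 \<Longrightarrow> cmod (b - z) < d / 4 \<Longrightarrow> cmod z \<le> R \<Longrightarrow> \<phi> z = 1"
  proof (rule cutoff_exists[where A = "\<Omega>\<^sub>1 - \<Omega>\<^sub>2" and B = "\<Omega>\<^sub>2 - \<Omega>\<^sub>1" and R = R])
    show "d \<le> cmod (a - b)" if "a \<in> \<Omega>\<^sub>1 - \<Omega>\<^sub>2" "b \<in> \<Omega>\<^sub>2 - \<Omega>\<^sub>1" for a b
      using that by (rule d(2))
  qed (rule d(1) ne(2) that; assumption)+
  define F1 where "F1 = (\<lambda>z. (if z \<in> ?W then \<phi> z * f z else 0) - dbar_correction ?W a f \<phi> z)"
  define F2 where "F2 = (\<lambda>z. (if z \<in> ?W then (1 - \<phi> z) * f z else 0) - dbar_correction ?W a f (\<lambda>z. 1 - \<phi> z) z)"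
  have oW: "open ?W" using o by auto
  \<comment> \<open>The radius \<open>d / 4\<close> comes from the cutoff, and its values are
    controlled because the intersection lies in \<open>cball 0 R\<close>.\<close>
  have near1: "\<forall>z0\<in>\<Omega>\<^sub>1 - ?W. \<exists>r>0. \<forall>z\<in>?W \<inter> ball z0 r. \<phi> z = 0"
  proof (intro ballI exI[of _ "d / 4"] conjI)
    fix z0 z assume "z0 \<in> \<Omega>\<^sub>1 - ?W" "z \<in> ?W \<inter> ball z0 (d / 4)"
    then show "\<phi> z = 0" using \<phi>(4)[of z0 z] R by (auto simp: dist_norm)
  qed (use d(1) in simp)
  have disj1: "\<Omega>\<^sub>1 \<inter> ball a \<rho> = {}" using a(1) by blast
  note c1 = cutoff_minus_dbar_correction[OF p oW R Int_lower1 o(1) disj1 a(2) f(2,3) \<phi>(1,2) near1]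
  have 1: "restrict F1 \<Omega>\<^sub>1 \<in> bergman_space p \<Omega>\<^sub>1" 
    unfolding F1_def by (rule bergman_space_restrict[OF c1])
  have near2: "\<forall>z0\<in>\<Omega>\<^sub>2 - ?W. \<exists>r>0. \<forall>z\<in>?W \<inter> ball z0 r. 1 - \<phi> z = 0"
  proof (intro ballI exI[of _ "d / 4"] conjI)
    fix z0 z assume "z0 \<in> \<Omega>\<^sub>2 - ?W" "z \<in> ?W \<inter> ball z0 (d / 4)"
    then show "1 - \<phi> z = 0" using \<phi>(5)[of z0 z] R by (auto simp: dist_norm)
  qed (use d(1) in simp)
  have disj2: "\<Omega>\<^sub>2 \<inter> ball a \<rho> = {}" using a(1) by blast
  note c2 = cutoff_minus_dbar_correction[OF p oW R Int_lower2 o(2) disj2 a(2) f(2,3)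
      C1_on_diff[OF C1_on_const \<phi>(1)] \<phi>(3) near2]
  have 2: "restrict F2 \<Omega>\<^sub>2 \<in> bergman_space p \<Omega>\<^sub>2" 
    unfolding F2_def by (rule bergman_space_restrict[OF c2])
  \<comment> \<open>The two corrections are therefore opposite and cancel in \<open>F1 + F2\<close>,
    leaving \<open>\<phi> * f + (1 - \<phi>) * f = f\<close>.\<close>
  have "dbar (\<lambda>z. 1 - \<phi> z) w = - dbar \<phi> w" for w
    using dbar_diff[of "\<lambda>_. 1" w \<phi>] \<phi>(1) by (simp add: C1_on_def)
  then have "dbar_correction ?W a f (\<lambda>z. 1 - \<phi> z) z = - dbar_correction ?W a f \<phi> z" for z
    unfolding dbar_correction_def minus_divide_left integral_minus[symmetric]
    by (intro arg_cong[of _ _ "\<lambda>x. x / (z - a) / (2 * of_real pompeiu_const)"] Bochner_Integration.integral_cong) auto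
  then have "f z = F1 z + F2 z" if "z \<in> ?W" for z
    using that by (simp add: F1_def F2_def algebra_simps)
  then show "f \<in> bergman_sum p \<Omega>\<^sub>1 \<Omega>\<^sub>2"
    by (intro bergman_sumI[OF f(1) 1 2]) auto
qed

theorem corollary1p2:
  fixes p :: real and \<Omega>\<^sub>1 \<Omega>\<^sub>2 :: "complex set"
  assumes "1 < p"
    and "open \<Omega>\<^sub>1" and "open \<Omega>\<^sub>2"
    and "\<Omega>\<^sub>1 \<inter> \<Omega>\<^sub>2 \<noteq> {}"
    and "set_distance (\<Omega>\<^sub>1 - \<Omega>\<^sub>2) (\<Omega>\<^sub>2 - \<Omega>\<^sub>1) > 0"
    and "bounded (\<Omega>\<^sub>1 \<inter> \<Omega>\<^sub>2)"
    and "closure (\<Omega>\<^sub>1 \<union> \<Omega>\<^sub>2) \<noteq> UNIV"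
  shows "bergman_space p (\<Omega>\<^sub>1 \<inter> \<Omega>\<^sub>2) = bergman_sum p \<Omega>\<^sub>1 \<Omega>\<^sub>2"
proof
  show "bergman_sum p \<Omega>\<^sub>1 \<Omega>\<^sub>2 \<subseteq> bergman_space p (\<Omega>\<^sub>1 \<inter> \<Omega>\<^sub>2)"
    using assms(1-3) by (rule bergman_sum_subset)
  show "bergman_space p (\<Omega>\<^sub>1 \<inter> \<Omega>\<^sub>2) \<subseteq> bergman_sum p \<Omega>\<^sub>1 \<Omega>\<^sub>2"
  \<comment> \<open>If a difference is empty, one set contains the other and \<open>f + 0\<close> is
    already a decomposition.\<close>
  proof (cases "\<Omega>\<^sub>1 - \<Omega>\<^sub>2 = {} \<or> \<Omega>\<^sub>2 - \<Omega>\<^sub>1 = {}")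
    case True
    show ?thesis
    proof
      fix f assume f: "f \<in> bergman_space p (\<Omega>\<^sub>1 \<inter> \<Omega>\<^sub>2)"
      then have ext: "f \<in> extensional (\<Omega>\<^sub>1 \<inter> \<Omega>\<^sub>2)" by (simp add: bergman_space_def)
      from True consider "\<Omega>\<^sub>1 \<inter> \<Omega>\<^sub>2 = \<Omega>\<^sub>1" | "\<Omega>\<^sub>1 \<inter> \<Omega>\<^sub>2 = \<Omega>\<^sub>2" by blast
      then show "f \<in> bergman_sum p \<Omega>\<^sub>1 \<Omega>\<^sub>2"
      proof cases
        case 1
        with f show ?thesis
          by (intro bergman_sumI[OF ext _ bergman_space_zero]) auto
      next
        case 2
        with f show ?thesis
          by (intro bergman_sumI[OF ext bergman_space_zero]) auto
      qed
    qed
  next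
    case False
    obtain d where d: "0 < d" "\<And>a b. a \<in> \<Omega>\<^sub>1 - \<Omega>\<^sub>2 \<Longrightarrow> b \<in> \<Omega>\<^sub>2 - \<Omega>\<^sub>1 \<Longrightarrow> d \<le> cmod (a - b)"
      using set_distance_pos[OF assms(5)] by blast
    obtain R where "\<forall>z\<in>\<Omega>\<^sub>1 \<inter> \<Omega>\<^sub>2. cmod z \<le> R"
      using assms(6) unfolding bounded_iff by blast
    then have R: "\<Omega>\<^sub>1 \<inter> \<Omega>\<^sub>2 \<subseteq> cball 0 R" by auto
    \<comment> \<open>The pole of the modified kernel needs a whole disc missing both sets, so that
      dividing by \<open>z - a\<close> stays bounded on them.\<close>
    obtain a where "a \<in> - closure (\<Omega>\<^sub>1 \<union> \<Omega>\<^sub>2)" using assms(7) by blast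
    then obtain \<rho> where \<rho>: "0 < \<rho>" "ball a \<rho> \<subseteq> - closure (\<Omega>\<^sub>1 \<union> \<Omega>\<^sub>2)"
      by (metis closed_closure openE open_Compl)
    have "(\<Omega>\<^sub>1 \<union> \<Omega>\<^sub>2) \<inter> ball a \<rho> = {}" using \<rho>(2) closure_subset by blast
    with False show ?thesis
      by (intro bergman_space_subset[OF assms(1-3) d _ _ R _ \<rho>(1)]) auto
  qed
qed

end
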